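(* For $1\le i<j\le 2n$ let $c_{ji}=\sum_{k<l}\widetilde b_{lk}\otimes\xi^{kl}_{ij}\in\widetilde{\mathcal B}\widetilde\otimes\mathscr{F}_R(M(2n))$, where $\xi^{kl}_{ij}$ are the $2\times 2$ dynamical quantum minors of $\mathscr{F}_R(M(2n))$, and let $C=(c_{ji})$. Then in $\widetilde{\mathcal B}\widetilde\otimes\mathscr{F}_R(M(2n))$ $$\widetilde{\mathrm{Pf}}(C)=\widetilde{\mathrm{Pf}}(\widetilde B)\otimes\det(T).$$
   Context: Notation: put $N=2n$, $[1,N]=\{1,\ldots,N\}$; $q\in\mathbb C^\times$ is generic; $\mathfrak h^*\cong\mathbb C^{N}$ with basis $e_1,\ldots,e_N$, $\omega(i)=e_i$; $M_{\mathfrak h^*}$ is the algebra of meromorphic functions $f(\underline\lambda)=f(\lambda_1,\ldots,\lambda_N)$ on $\mathfrak h^*$. Set $h(\lambda)=q\dfrac{q^{-2\lambda}-q^{-2}}{q^{-2\lambda}-1}$, $g(\lambda)=h(\lambda)h(-\lambda)$. $\mathscr{F}_R(M(N))$ is the associative algebra generated by $t_{ij}$ ($1\le i,j\le N$) and two copies of $M_{\mathfrak h^*}$ embedded as subalgebras, with elements $f(\underline\lambda)=\mu_l(f)$ and $f(\underline\mu)=\mu_r(f)$, subject to: $f_1(\underline\lambda)f_2(\underline\mu)=f_2(\underline\mu)f_1(\underline\lambda)$, $f(\underline\lambda)t_{ij}=t_{ij}f(\underline\lambda+\omega(i))$, $f(\underline\mu)t_{ij}=t_{ij}f(\underline\mu+\omega(j))$,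 and - $h(\mu_k-\mu_l)t_{ik}t_{il}=t_{il}t_{ik}$ for $k<l$; - $h(\lambda_j-\lambda_i)t_{jk}t_{ik}=t_{ik}t_{jk}$ for $i<j$; - $t_{ik}t_{jl}=t_{jl}t_{ik}+(h(\lambda_j-\lambda_i)-h(\mu_k-\mu_l))t_{jk}t_{il}$ for $i<j$, $k<l$; - $g(\mu_k-\mu_l)t_{ik}t_{jl}=g(\lambda_i-\lambda_j)t_{jl}t_{ik}+(h(\mu_l-\mu_k)-h(\lambda_i-\lambda_j))t_{il}t_{jk}$ for $i<j$, $k<l$. For $I=\{i_1<\cdots<i_r\}\subset[1,N]$ and $\sigma\in S_r$, set $S(\sigma,I)(\underline\lambda)=\prod_{k<l,\ \sigma(k)>\sigma(l)}(-h(\lambda_{i_{\sigma(k)}}-\lambda_{i_{\sigma(l)}}))$ and $\widetilde S(\sigma,I)(\underline\lambda)=\prod_{k<l,\ \sigma(k)>\sigma(l)}(-h(\lambda_{i_{\sigma(l)}}-\lambda_{i_{\sigma(k)}}))$. For $J=\{j_1<\cdots<j_r\}$ the dynamical quantum minor is $\xi^I_J=\mu_r(S(\rho,J)^{-1})\sum_{\sigma\in S_r}\mu_l(S(\sigma,I))\,t_{i_{\sigma(1)}j_{\rho(1)}}\cdots t_{i_{\sigma(r)}j_{\rho(r)}}$, which is independent of $\rho\in S_r$ (one may take $\rho=\mathrm{id}$). Write $\xi^{kl}_{ij}=\xi^{\{k,l\}}_{\{i,j\}}$ for $k<l$, $i<j$, and $\det(T)=\xi^{[1,N]}_{[1,N]}$,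 where $T=(t_{ij})$. $\widetilde{\mathcal B}$ is the algebra generated by $\widetilde b_{ji}$, $1\le i<j\le 2n$, and a copy of $M_{\mathfrak h^*}$ embedded as a subalgebra, its elements denoted by $f(\underline\lambda)$ (no further relations are specified). $\widetilde{\mathcal B}\widetilde\otimes\mathscr{F}_R(M(2n))$ denotes the usual tensor product (with factorwise products) modulo the relations $b\otimes\mu_l(f)t=fb\otimes t$ and $f(b\otimes t)=b\otimes\mu_r(f)t$ for $f\in M_{\mathfrak h^*}$; the second describes how $f$ acts on the left. For $X=(x_{ji})_{1\le i<j\le 2n}$ (here $X=\widetilde B=(\widetilde b_{ji})$ in $\widetilde{\mathcal B}$, or $X=C$ in $\widetilde{\mathcal B}\widetilde\otimes\mathscr{F}_R(M(2n))$), the dynamical quantum Pfaffian is $$\widetilde{\mathrm{Pf}}(X)=\sum_{\sigma}\widetilde S(\sigma,[1,2n])\,x_{\sigma(2n)\sigma(2n-1)}x_{\sigma(2n-2)\sigma(2n-3)}\cdots x_{\sigma(2)\sigma(1)},$$ the sum over all $\sigma\in S_{2n}$ with $\sigma(2k-1)<\sigma(2k)$ for $k=1,\ldots,n$ (the order of the pairs is not restricted).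
   Formalization: The asserted independence of the 2×2 minors ξ^{kl}_{ij} of ρ does not follow from the listed relations of F_R(M(2n)) (only after multiplying by h(λ_j−λ_i)−h(μ_k−μ_l), not invertible), so this independence is added as a further family of relations of F_R(M(2n)). *)

theory Defs
  imports "HOL-Analysis.Analysis" "HOL-Combinatorics.Permutations" "HOL-Library.Poly_Mapping"
begin

section \<open>Meromorphic functions of several complex variables\<close>

text \<open>
  The coordinates of the dual Cartan algebra are indexed by a finite linearly ordered type
  \<open>'n\<close>, which plays the role of \<open>{1,\<dots>,N}\<close>.  Holomorphic means complex Frechet differentiable;
  a meromorphic function is locally a quotient of holomorphic functions whose denominator does
  not vanish identically on any nonempty open set.  Values on the zero set of the denominators
  are irrelevant, so two such functions are identified when they agree on a dense open set.
\<close>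

definition holo_on :: "(complex^'n::finite \<Rightarrow> complex) \<Rightarrow> (complex^'n) set \<Rightarrow> bool" where
  "holo_on f U \<longleftrightarrow>
     (\<forall>z\<in>U. \<exists>D. (f has_derivative D) (at z) \<and> (\<forall>c v. D (c *s v) = c * D v))"

definition nonvan_on :: "(complex^'n::finite \<Rightarrow> complex) \<Rightarrow> (complex^'n) set \<Rightarrow> bool" where
  "nonvan_on h U \<longleftrightarrow> (\<forall>V. open V \<and> V \<noteq> {} \<and> V \<subseteq> U \<longrightarrow> (\<exists>w\<in>V. h w \<noteq> 0))"

definition merom :: "(complex^'n::finite \<Rightarrow> complex) \<Rightarrow> bool" where
  "merom f \<longleftrightarrow> (\<forall>z. \<exists>U g h. open U \<and> z \<in> U \<and> holo_on g U \<and> holo_on h U \<and> nonvan_on h U \<and>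
                  (\<forall>w\<in>U. h w \<noteq> 0 \<longrightarrow> f w = g w / h w))"

definition agree :: "(complex^'n::finite \<Rightarrow> complex) \<Rightarrow> (complex^'n \<Rightarrow> complex) \<Rightarrow> bool" where
  "agree f g \<longleftrightarrow> (\<exists>W. open W \<and> closure W = UNIV \<and> (\<forall>w\<in>W. f w = g w))"

lemma holo_onD_cont: "holo_on f U \<Longrightarrow> open U \<Longrightarrow> continuous_on U f"
  unfolding holo_on_def
  by (metis continuous_at_imp_continuous_on has_derivative_continuous)

lemma holo_on_subset: "holo_on f U \<Longrightarrow> V \<subseteq> U \<Longrightarrow> holo_on f V"
  unfolding holo_on_def by blast

lemma nonvan_on_subset: "nonvan_on f U \<Longrightarrow> V \<subseteq> U \<Longrightarrow> nonvan_on f V"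
  unfolding nonvan_on_def by blast

lemma holo_on_const [simp]: "holo_on (\<lambda>_. c) U"
  unfolding holo_on_def by (auto intro!: exI[of _ "\<lambda>_. 0"])

lemma holo_on_add: "holo_on f U \<Longrightarrow> holo_on g U \<Longrightarrow> holo_on (\<lambda>x. f x + g x) U"
  unfolding holo_on_def
proof (intro ballI)
  fix z assume *: "\<forall>z\<in>U. \<exists>D. (f has_derivative D) (at z) \<and> (\<forall>c v. D (c *s v) = c * D v)"
    "\<forall>z\<in>U. \<exists>D. (g has_derivative D) (at z) \<and> (\<forall>c v. D (c *s v) = c * D v)" and "z \<in> U"
  then obtain D E where "(f has_derivative D) (at z)" "\<forall>c v. D (c *s v) = c * D v"
    "(g has_derivative E) (at z)" "\<forall>c v. E (c *s v) = c * E v" by meson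
  then show "\<exists>D. ((\<lambda>x. f x + g x) has_derivative D) (at z) \<and> (\<forall>c v. D (c *s v) = c * D v)"
    by (intro exI[of _ "\<lambda>v. D v + E v"] conjI has_derivative_add) (auto simp: algebra_simps)
qed

lemma holo_on_mult: "holo_on f U \<Longrightarrow> holo_on g U \<Longrightarrow> holo_on (\<lambda>x. f x * g x) U"
  unfolding holo_on_def
proof (intro ballI)
  fix z assume *: "\<forall>z\<in>U. \<exists>D. (f has_derivative D) (at z) \<and> (\<forall>c v. D (c *s v) = c * D v)"
    "\<forall>z\<in>U. \<exists>D. (g has_derivative D) (at z) \<and> (\<forall>c v. D (c *s v) = c * D v)" and "z \<in> U"
  then obtain D E where "(f has_derivative D) (at z)" "\<forall>c v. D (c *s v) = c * D v"
    "(g has_derivative E) (at z)" "\<forall>c v. E (c *s v) = c * E v" by meson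
  then show "\<exists>D. ((\<lambda>x. f x * g x) has_derivative D) (at z) \<and> (\<forall>c v. D (c *s v) = c * D v)"
    by (intro exI[of _ "\<lambda>v. f z * E v + D v * g z"] conjI has_derivative_mult)
       (auto simp: algebra_simps)
qed

lemma holo_on_uminus: "holo_on f U \<Longrightarrow> holo_on (\<lambda>x. - f x) U"
  using holo_on_mult[of "\<lambda>_. -1" U f] by simp

lemma holo_on_shift:
  assumes "holo_on f U" shows "holo_on (\<lambda>x. f (x + a)) ((\<lambda>x. x + a) -` U)"
  unfolding holo_on_def
proof (intro ballI)
  fix z assume "z \<in> (\<lambda>x. x + a) -` U"
  then obtain D where D: "(f has_derivative D) (at (z + a))" "\<forall>c v. D (c *s v) = c * D v"
    using assms unfolding holo_on_def by blast
  have "((\<lambda>x. x + a) has_derivative (\<lambda>v. v)) (at z)"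
    by (auto intro!: derivative_eq_intros)
  then have "((\<lambda>x. f (x + a)) has_derivative (\<lambda>v. D v)) (at z)"
    using has_derivative_compose[of "\<lambda>x. x + a" "\<lambda>v. v" z UNIV f D] D by simp
  then show "\<exists>D. ((\<lambda>x. f (x + a)) has_derivative D) (at z) \<and> (\<forall>c v. D (c *s v) = c * D v)"
    using D by blast
qed

lemma nonvan_on_mult:
  assumes "nonvan_on g U" "nonvan_on h U" "continuous_on U g" "open U"
  shows "nonvan_on (\<lambda>x. g x * h x) U"
  unfolding nonvan_on_def
proof (intro allI impI)
  fix V assume V: "open V \<and> V \<noteq> {} \<and> V \<subseteq> U"
  then obtain w where w: "w \<in> V" "g w \<noteq> 0" using assms(1) unfolding nonvan_on_def by blast
  have "continuous_on V g" using assms(3) V continuous_on_subset by blast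
  then have "open (V \<inter> g -` (- {0}))"
    using V by (intro continuous_open_preimage) auto
  moreover have "V \<inter> g -` (- {0}) \<noteq> {}" using w by blast
  moreover have "V \<inter> g -` (- {0}) \<subseteq> U" using V by blast
  ultimately have "\<exists>w'\<in>V \<inter> g -` (- {0}). h w' \<noteq> 0"
    using assms(2) unfolding nonvan_on_def by simp
  then show "\<exists>w\<in>V. g w * h w \<noteq> 0" by auto
qed

lemma nonvan_on_shift:
  assumes "nonvan_on h U"
  shows "nonvan_on (\<lambda>x. h (x + a)) ((\<lambda>x. x + a) -` U)"
  unfolding nonvan_on_def
proof (intro allI impI)
  fix V assume V: "open V \<and> V \<noteq> {} \<and> V \<subseteq> (\<lambda>x. x + a) -` U"
  have "open ((\<lambda>x. x + a) ` V)" using V open_translation[of V a] by (simp add: add.commute)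
  moreover have "(\<lambda>x. x + a) ` V \<noteq> {}" "(\<lambda>x. x + a) ` V \<subseteq> U" using V by auto
  ultimately have "\<exists>w\<in>(\<lambda>x. x + a) ` V. h w \<noteq> 0" using assms unfolding nonvan_on_def by blast
  then show "\<exists>w\<in>V. h (w + a) \<noteq> 0" by blast
qed

lemma merom_holo_quot:
  assumes "holo_on g UNIV" "holo_on h UNIV" "nonvan_on h UNIV"
    "\<And>w. h w \<noteq> 0 \<Longrightarrow> f w = g w / h w"
  shows "merom f"
  unfolding merom_def
  by (intro allI exI[of _ UNIV] exI[of _ g] exI[of _ h]) (use assms in auto)

lemma nonvan_on_const [simp]: "c \<noteq> 0 \<Longrightarrow> nonvan_on (\<lambda>_. c) U"
  unfolding nonvan_on_def by auto

lemma merom_const [simp]: "merom (\<lambda>_. c)"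
  by (rule merom_holo_quot[of "\<lambda>_. c" "\<lambda>_. 1"]) auto

lemma merom_obtain2:
  assumes "merom f1" "merom f2"
  obtains U g1 h1 g2 h2 where "open U" "z \<in> U"
    "holo_on g1 U" "holo_on h1 U" "nonvan_on h1 U" "\<And>w. w \<in> U \<Longrightarrow> h1 w \<noteq> 0 \<Longrightarrow> f1 w = g1 w / h1 w"
    "holo_on g2 U" "holo_on h2 U" "nonvan_on h2 U" "\<And>w. w \<in> U \<Longrightarrow> h2 w \<noteq> 0 \<Longrightarrow> f2 w = g2 w / h2 w"
proof -
  obtain U1 g1 h1 where 1: "open U1" "z \<in> U1" "holo_on g1 U1" "holo_on h1 U1" "nonvan_on h1 U1"
    "\<forall>w\<in>U1. h1 w \<noteq> 0 \<longrightarrow> f1 w = g1 w / h1 w" using assms(1) unfolding merom_def by meson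
  obtain U2 g2 h2 where 2: "open U2" "z \<in> U2" "holo_on g2 U2" "holo_on h2 U2" "nonvan_on h2 U2"
    "\<forall>w\<in>U2. h2 w \<noteq> 0 \<longrightarrow> f2 w = g2 w / h2 w" using assms(2) unfolding merom_def by meson
  show thesis
    by (rule that[of "U1 \<inter> U2" g1 h1 g2 h2])
       (use 1 2 in \<open>auto intro: holo_on_subset nonvan_on_subset\<close>)
qed

lemma merom_add:
  assumes "merom f1" "merom f2" shows "merom (\<lambda>x. f1 x + f2 x)"
  unfolding merom_def
proof
  fix z
  obtain U g1 h1 g2 h2 where *: "open U" "z \<in> U"
    "holo_on g1 U" "holo_on h1 U" "nonvan_on h1 U" "\<And>w. w \<in> U \<Longrightarrow> h1 w \<noteq> 0 \<Longrightarrow> f1 w = g1 w / h1 w"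
    "holo_on g2 U" "holo_on h2 U" "nonvan_on h2 U" "\<And>w. w \<in> U \<Longrightarrow> h2 w \<noteq> 0 \<Longrightarrow> f2 w = g2 w / h2 w"
    using merom_obtain2[OF assms] by blast
  show "\<exists>U g h. open U \<and> z \<in> U \<and> holo_on g U \<and> holo_on h U \<and> nonvan_on h U \<and>
          (\<forall>w\<in>U. h w \<noteq> 0 \<longrightarrow> f1 w + f2 w = g w / h w)"
    by (intro exI[of _ U] exI[of _ "\<lambda>w. g1 w * h2 w + g2 w * h1 w"] exI[of _ "\<lambda>w. h1 w * h2 w"])
       (use * in \<open>auto intro!: holo_on_mult holo_on_add nonvan_on_mult holo_onD_cont
                       simp: add_frac_eq\<close>)
qed

lemma merom_mult:
  assumes "merom f1" "merom f2" shows "merom (\<lambda>x. f1 x * f2 x)"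
  unfolding merom_def
proof
  fix z
  obtain U g1 h1 g2 h2 where *: "open U" "z \<in> U"
    "holo_on g1 U" "holo_on h1 U" "nonvan_on h1 U" "\<And>w. w \<in> U \<Longrightarrow> h1 w \<noteq> 0 \<Longrightarrow> f1 w = g1 w / h1 w"
    "holo_on g2 U" "holo_on h2 U" "nonvan_on h2 U" "\<And>w. w \<in> U \<Longrightarrow> h2 w \<noteq> 0 \<Longrightarrow> f2 w = g2 w / h2 w"
    using merom_obtain2[OF assms] by blast
  show "\<exists>U g h. open U \<and> z \<in> U \<and> holo_on g U \<and> holo_on h U \<and> nonvan_on h U \<and>
          (\<forall>w\<in>U. h w \<noteq> 0 \<longrightarrow> f1 w * f2 w = g w / h w)"
    by (intro exI[of _ U] exI[of _ "\<lambda>w. g1 w * g2 w"] exI[of _ "\<lambda>w. h1 w * h2 w"])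
       (use * in \<open>auto intro!: holo_on_mult nonvan_on_mult holo_onD_cont\<close>)
qed

lemma merom_uminus: "merom f \<Longrightarrow> merom (\<lambda>x. - f x)"
  using merom_mult[of "\<lambda>_. -1" f] by simp

lemma merom_shift:
  assumes "merom f" shows "merom (\<lambda>x. f (x + a))"
  unfolding merom_def
proof
  fix z
  obtain U g h where *: "open U" "z + a \<in> U" "holo_on g U" "holo_on h U" "nonvan_on h U"
    "\<forall>w\<in>U. h w \<noteq> 0 \<longrightarrow> f w = g w / h w" using assms unfolding merom_def by meson
  have "open ((\<lambda>x. x + a) -` U)" using * by (intro open_vimage continuous_intros) auto
  then show "\<exists>U g h. open U \<and> z \<in> U \<and> holo_on g U \<and> holo_on h U \<and> nonvan_on h U \<and>
          (\<forall>w\<in>U. h w \<noteq> 0 \<longrightarrow> f (w + a) = g w / h w)"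
    by (intro exI[of _ "(\<lambda>x. x + a) -` U"] exI[of _ "\<lambda>x. g (x + a)"] exI[of _ "\<lambda>x. h (x + a)"])
       (use * in \<open>auto intro: holo_on_shift nonvan_on_shift\<close>)
qed

lemma agree_refl [simp]: "agree f f"
  unfolding agree_def by (intro exI[of _ UNIV]) auto

lemma agree_sym: "agree f g \<Longrightarrow> agree g f"
  unfolding agree_def by auto

lemma dense_Int:
  fixes V W :: "'a::topological_space set"
  assumes "open V" "closure V = UNIV" "open W" "closure W = UNIV"
  shows "closure (V \<inter> W) = UNIV"
proof -
  have "W \<subseteq> closure (V \<inter> W)"
    using open_Int_closure_subset[OF assms(3), of V] assms(2) by (simp add: Int_commute)
  then have "closure W \<subseteq> closure (V \<inter> W)" by (meson closed_closure closure_minimal)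
  then show ?thesis using assms(4) by auto
qed

lemma agree_combine:
  assumes "agree f f'" "agree g g'" and "\<And>w. f w = f' w \<Longrightarrow> g w = g' w \<Longrightarrow> k w = k' w"
  shows "agree k k'"
proof -
  obtain V W where "open V" "closure V = UNIV" "\<forall>w\<in>V. f w = f' w"
    "open W" "closure W = UNIV" "\<forall>w\<in>W. g w = g' w"
    using assms(1,2) unfolding agree_def by blast
  then show ?thesis
    unfolding agree_def by (intro exI[of _ "V \<inter> W"]) (auto simp: dense_Int intro: assms(3))
qed

lemma agree_trans: "agree f g \<Longrightarrow> agree g k \<Longrightarrow> agree f k"
  by (rule agree_combine[of f g g k]) auto

lemma agree_shift:
  assumes "agree f g" shows "agree (\<lambda>x. f (x + a)) (\<lambda>x. g (x + a))"
proof -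
  obtain W where W: "open W" "closure W = UNIV" "\<forall>w\<in>W. f w = g w"
    using assms unfolding agree_def by blast
  have "closure ((\<lambda>x. -a + x) ` W) = (\<lambda>x. -a + x) ` closure W" by (rule closure_translation)
  also have "\<dots> = UNIV" unfolding W(2) by (metis surj_plus)
  finally have "closure ((\<lambda>x. -a + x) ` W) = UNIV" .
  moreover have "open ((\<lambda>x. -a + x) ` W)" using W(1) by (rule open_translation)
  ultimately show ?thesis
    unfolding agree_def using W(3) by (intro exI[of _ "(\<lambda>x. -a + x) ` W"]) auto
qed

quotient_type ('n) mero = "complex^'n::finite \<Rightarrow> complex" / partial:
  "\<lambda>f g. merom f \<and> merom g \<and> agree f g"
proof (rule part_equivpI)
  show "\<exists>x. merom x \<and> merom x \<and> agree x x" by (rule exI[of _ "\<lambda>_. 0"]) simp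
  show "symp (\<lambda>f g. merom f \<and> merom g \<and> agree f g)" by (auto intro!: sympI agree_sym)
  show "transp (\<lambda>f g. merom f \<and> merom g \<and> agree f g)"
    by (rule transpI) (elim conjE, intro conjI, assumption+, rule agree_trans)
qed

instantiation mero :: (finite) comm_ring_1
begin

lift_definition zero_mero :: "'a mero" is "\<lambda>_. 0" by simp
lift_definition one_mero :: "'a mero" is "\<lambda>_. 1" by simp
lift_definition plus_mero :: "'a mero \<Rightarrow> 'a mero \<Rightarrow> 'a mero" is "\<lambda>f g x. f x + g x"
  by (elim conjE, intro conjI merom_add, assumption+, erule (1) agree_combine) simp
lift_definition times_mero :: "'a mero \<Rightarrow> 'a mero \<Rightarrow> 'a mero" is "\<lambda>f g x. f x * g x"
  by (elim conjE, intro conjI merom_mult, assumption+, erule (1) agree_combine) simp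
lift_definition uminus_mero :: "'a mero \<Rightarrow> 'a mero" is "\<lambda>f x. - f x"
  by (elim conjE, intro conjI merom_uminus, assumption+)
     (rule agree_combine, assumption, assumption, simp)
definition minus_mero :: "'a mero \<Rightarrow> 'a mero \<Rightarrow> 'a mero" where "minus_mero f g = f + - g"

lemma not_agree_0_1: "\<not> agree (\<lambda>_. 0) (\<lambda>_. 1)"
  unfolding agree_def by auto

instance
proof
  fix a b c :: "'a mero"
  show "a + b + c = a + (b + c)"
    by transfer
      (elim conjE, intro conjI merom_add merom_mult merom_uminus merom_const, assumption+, simp add: add.assoc)
  show "a + b = b + a"
    by transfer
      (elim conjE, intro conjI merom_add merom_mult merom_uminus merom_const, assumption+, simp add: add.commute)
  show "0 + a = a" by transfer simp
  show "- a + a = 0"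
    by transfer
      (elim conjE, intro conjI merom_add merom_mult merom_uminus merom_const, assumption+, simp add: add.commute)
  show "a - b = a + - b" by (rule minus_mero_def)
  show "a * b * c = a * (b * c)"
    by transfer
      (elim conjE, intro conjI merom_add merom_mult merom_uminus merom_const, assumption+, simp add: mult.assoc)
  show "a * b = b * a"
    by transfer
      (elim conjE, intro conjI merom_add merom_mult merom_uminus merom_const, assumption+, simp add: mult.commute)
  show "1 * a = a" by transfer simp
  show "(a + b) * c = a * c + b * c"
    by transfer
      (elim conjE, intro conjI merom_add merom_mult merom_uminus merom_const, assumption+, simp add: distrib_right)
  show "(0::'a mero) \<noteq> 1" by transfer (simp add: not_agree_0_1)
qed

end

lift_definition mero_const :: "complex \<Rightarrow> ('n::finite) mero" is "\<lambda>c _. c" by simp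

lift_definition mero_shift :: "'n::finite \<Rightarrow> 'n mero \<Rightarrow> 'n mero" is
  "\<lambda>i f x. f (x + axis i 1)"
  by (elim conjE, intro conjI merom_shift agree_shift)


section \<open>The functions h and g\<close>

text \<open>
  Powers of \<open>q\<close> with complex exponent require a logarithm of \<open>q\<close>.  The parameter \<open>l\<close> is an
  arbitrary choice of it: \<open>q = exp l\<close>.
\<close>

definition qpow :: "complex \<Rightarrow> complex \<Rightarrow> complex" where
  "qpow l x = exp (l * x)"

definition hfun :: "complex \<Rightarrow> complex \<Rightarrow> complex" where
  "hfun l x = qpow l 1 * ((qpow l (- 2 * x) - qpow l (- 2)) / (qpow l (- 2 * x) - 1))"

lemma holo_qpow_diff: "holo_on (\<lambda>x. qpow l (- 2 * (x $ i - x $ j))) U"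
  unfolding holo_on_def qpow_def
proof
  fix z :: "complex^'a"
  let ?e = "\<lambda>x::complex^'a. l * (- 2 * (x $ i - x $ j))"
  have e: "(?e has_derivative ?e) (at z)"
  proof -
    have "((\<lambda>x::complex^'a. x $ i - x $ j) has_derivative (\<lambda>v. v $ i - v $ j)) (at z)"
      by (rule has_derivative_diff[OF bounded_linear_imp_has_derivative[OF bounded_linear_vec_nth]
            bounded_linear_imp_has_derivative[OF bounded_linear_vec_nth]])
    then show ?thesis by (rule has_derivative_mult_right[OF has_derivative_mult_right])
  qed
  have "(exp has_derivative (*) (exp (?e z))) (at (?e z))"
    using DERIV_exp[of "?e z"] by (simp only: has_field_derivative_def)
  from has_derivative_compose[OF e this]
  have "((\<lambda>x. exp (?e x)) has_derivative (\<lambda>v. exp (?e z) * ?e v)) (at z)" .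
  moreover have "\<forall>c v. exp (?e z) * ?e (c *s v) = c * (exp (?e z) * ?e v)"
    by (simp add: right_diff_distrib)
  ultimately show "\<exists>D. ((\<lambda>x. exp (?e x)) has_derivative D) (at z) \<and> (\<forall>c v. D (c *s v) = c * D v)"
    by blast
qed

lemma exp_eq_1_small: "exp z = 1 \<Longrightarrow> norm z < 1 \<Longrightarrow> z = (0::complex)"
proof -
  assume "exp z = 1" "norm z < 1"
  then obtain k :: int where k: "Re z = 0" "Im z = of_int (2 * k) * pi"
    using exp_eq_1[of z] by auto
  have "\<bar>Im z\<bar> < 1" using abs_Im_le_cmod[of z] \<open>norm z < 1\<close> by linarith
  have "k = 0"
  proof (rule ccontr)
    assume "k \<noteq> 0"
    then have "1 \<le> \<bar>real_of_int k\<bar>" by linarith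
    then have "2 * 3 \<le> 2 * (\<bar>real_of_int k\<bar> * pi)"
      using pi_gt3 mult_mono[of 1 "\<bar>real_of_int k\<bar>" 3 pi] by (simp add: mult.commute)
    then show False using k(2) \<open>\<bar>Im z\<bar> < 1\<close> by (simp add: abs_mult mult.commute)
  qed
  then show "z = 0" using k by (simp add: complex_eq_iff)
qed

lemma nonvan_qpow_diff:
  fixes i j :: "'n::finite"
  assumes "l \<noteq> 0" "i \<noteq> j"
  shows "nonvan_on (\<lambda>x::complex^'n. qpow l (- 2 * (x $ i - x $ j)) - 1) U"
  unfolding nonvan_on_def
proof (intro allI impI)
  fix V :: "(complex^'n) set" assume V: "open V \<and> V \<noteq> {} \<and> V \<subseteq> U"
  then obtain w r where w: "w \<in> V" "r > 0" "ball w r \<subseteq> V" by (meson all_not_in_conv openE)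
  define d where "d = min (r / 2) (1 / (4 * norm l))"
  have d: "d > 0" "d < r" "d \<le> 1 / (4 * norm l)" using w assms by (auto simp: d_def min_def)
  have "norm (l * (- 2 * complex_of_real d)) = 2 * norm l * d" using d by (simp add: norm_mult)
  also have "\<dots> \<le> 2 * norm l * (1 / (4 * norm l))" using d by (intro mult_left_mono) auto
  also have "\<dots> < 1" using assms by simp
  finally have small: "norm (l * (- 2 * complex_of_real d)) < 1" .
  define w' where "w' = w + axis i (complex_of_real d)"
  have "(norm (axis i (complex_of_real d) :: complex^'n))\<^sup>2 = (\<Sum>k\<in>UNIV. if k = i then d\<^sup>2 else 0)"
    unfolding norm_vec_def L2_set_def
    by (subst real_sqrt_pow2) (use d in \<open>auto intro!: sum_nonneg sum.cong simp: axis_def simp del: sum.delta\<close>)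
  then have "norm (axis i (complex_of_real d) :: complex^'n) = d"
    using d by (simp add: power2_eq_iff_nonneg)
  then have "w' \<in> V" using w d unfolding w'_def by (auto simp: dist_norm subset_iff)
  have eq: "w' $ i - w' $ j = (w $ i - w $ j) + complex_of_real d"
    using assms(2) by (simp add: w'_def axis_def)
  have "qpow l (- 2 * (w' $ i - w' $ j)) =
        qpow l (- 2 * (w $ i - w $ j)) * exp (l * (- 2 * complex_of_real d))"
    unfolding eq qpow_def by (simp add: exp_add[symmetric] algebra_simps)
  moreover have "exp (l * (- 2 * complex_of_real d)) \<noteq> 1"
    using exp_eq_1_small[OF _ small] d assms by auto
  ultimately have "qpow l (- 2 * (w $ i - w $ j)) - 1 \<noteq> 0 \<or> qpow l (- 2 * (w' $ i - w' $ j)) - 1 \<noteq> 0"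
    by auto
  then show "\<exists>x\<in>V. qpow l (- 2 * (x $ i - x $ j)) - 1 \<noteq> 0" using w(1) \<open>w' \<in> V\<close> by blast
qed

lemma merom_hfun_diff: "merom (\<lambda>x::complex^'n::finite. hfun l (x $ i - x $ j))"
proof (cases "l = 0 \<or> i = j")
  case True
  then have "(\<lambda>x::complex^'n. hfun l (x $ i - x $ j)) = (\<lambda>_. 0)"
    by (auto simp: hfun_def qpow_def)
  then show ?thesis by simp
next
  case False
  let ?g = "\<lambda>x::complex^'n. qpow l 1 * (qpow l (- 2 * (x $ i - x $ j)) + - qpow l (- 2))"
  let ?h = "\<lambda>x::complex^'n. qpow l (- 2 * (x $ i - x $ j)) + - 1"
  have "holo_on ?g UNIV"
    by (rule holo_on_mult[OF holo_on_const holo_on_add[OF holo_qpow_diff holo_on_const]])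
  moreover have "holo_on ?h UNIV" by (rule holo_on_add[OF holo_qpow_diff holo_on_const])
  moreover have "nonvan_on ?h UNIV"
    using nonvan_qpow_diff[of l i j UNIV] False by (simp only: diff_conv_add_uminus de_Morgan_disj simp_thms)
  moreover have "hfun l (x $ i - x $ j) = ?g x / ?h x" for x
    unfolding hfun_def by (simp only: diff_conv_add_uminus times_divide_eq_right)
  ultimately show ?thesis by (rule merom_holo_quot)
qed

text \<open>The meromorphic functions \<open>h (\<lambda>\<^sub>i - \<lambda>\<^sub>j)\<close> and \<open>g (\<lambda>\<^sub>i - \<lambda>\<^sub>j)\<close>.\<close>

lift_definition hm :: "complex \<Rightarrow> 'n::finite \<Rightarrow> 'n \<Rightarrow> 'n mero" is
  "\<lambda>l i j x. hfun l (x $ i - x $ j)"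
  by (simp add: merom_hfun_diff)

definition gm :: "complex \<Rightarrow> 'n::finite \<Rightarrow> 'n \<Rightarrow> 'n mero" where
  "gm l i j = hm l i j * hm l j i"


section \<open>Free algebras and their two-sided ideals\<close>

text \<open>
  The free complex algebra on \<open>'g\<close> is the monoid algebra of words; the monoid of exponents of
  a \<open>poly_mapping\<close> is written additively, so concatenation of words becomes addition.
\<close>

datatype 'g word = Word (letters: "'g list")

instantiation word :: (type) monoid_add
begin
definition zero_word :: "'a word" where "zero_word = Word []"
definition plus_word :: "'a word \<Rightarrow> 'a word \<Rightarrow> 'a word" where
  "plus_word u v = Word (letters u @ letters v)"
instance by standard (auto simp: zero_word_def plus_word_def)
end

type_synonym 'g free_alg = "'g word \<Rightarrow>\<^sub>0 complex"

definition gen :: "'g \<Rightarrow> 'g free_alg" where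
  "gen x = Poly_Mapping.single (Word [x]) 1"

definition cscale :: "complex \<Rightarrow> ('k::monoid_add \<Rightarrow>\<^sub>0 complex) \<Rightarrow> ('k \<Rightarrow>\<^sub>0 complex)" where
  "cscale c x = Poly_Mapping.single 0 c * x"

interpretation cs: vector_space cscale
proof
  fix a b :: complex and x y :: "'k::monoid_add \<Rightarrow>\<^sub>0 complex"
  show "cscale a (x + y) = cscale a x + cscale a y" by (simp add: cscale_def distrib_left)
  show "cscale (a + b) x = cscale a x + cscale b x"
    by (simp add: cscale_def single_add distrib_right)
  show "cscale a (cscale b x) = cscale (a * b) x"
    by (simp add: cscale_def mult.assoc[symmetric] mult_single)
  show "cscale 1 x = x" by (simp add: cscale_def)
qed

definition ideal_gen :: "('k::monoid_add \<Rightarrow>\<^sub>0 complex) set \<Rightarrow> ('k \<Rightarrow>\<^sub>0 complex) set" where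
  "ideal_gen R = cs.span {a * r * b | a r b. r \<in> R}"

text \<open>
  Relations making \<open>\<iota>\<close> a homomorphism of complex algebras from the meromorphic functions.
\<close>

definition mero_rels :: "('n::finite mero \<Rightarrow> 'g free_alg) \<Rightarrow> 'g free_alg set" where
  "mero_rels \<iota> =
     {\<iota> (f1 + f2) - (\<iota> f1 + \<iota> f2) | f1 f2. True} \<union>
     {\<iota> (f1 * f2) - \<iota> f1 * \<iota> f2 | f1 f2. True} \<union>
     {\<iota> (mero_const c) - cscale c 1 | c. True}"


section \<open>The algebra of the dynamical quantum matrices\<close>

text \<open>
  The algebra is represented by the free algebra on the generators together with the ideal
  \<open>FR_ideal l\<close>: the elements of the algebra are the classes modulo this ideal.
\<close>

datatype 'n fr_gen = GT 'n 'n | Lf "'n mero" | Rf "'n mero"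

definition t_el :: "'n::finite \<Rightarrow> 'n \<Rightarrow> 'n fr_gen free_alg" where "t_el i j = gen (GT i j)"
definition mu_l :: "'n::finite mero \<Rightarrow> 'n fr_gen free_alg" where "mu_l f = gen (Lf f)"
definition mu_r :: "'n::finite mero \<Rightarrow> 'n fr_gen free_alg" where "mu_r f = gen (Rf f)"

text \<open>
  The last family says that the minor on the rows \<open>i < j\<close> and the columns \<open>k < m\<close> is
  the same when computed with either ordering \<open>\<rho>\<close> of the columns (multiplied by the
  invertible function \<open>S(\<rho>, {k,m})\<close>).  It is one of the components of
  the dynamical RTT relation.  Modulo the families before it, its two sides only become equal after
  multiplication by \<open>h (\<mu>\<^sub>m - \<mu>\<^sub>k) - h (\<lambda>\<^sub>i - \<lambda>\<^sub>j)\<close>, which is not invertible when the two copies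
  of the meromorphic functions are combined by the algebraic tensor product, as they are here.
\<close>

definition FR_rels :: "complex \<Rightarrow> 'n::{finite,linorder} fr_gen free_alg set" where
  "FR_rels l =
     mero_rels mu_l \<union> mero_rels mu_r \<union>
     {mu_l f1 * mu_r f2 - mu_r f2 * mu_l f1 | f1 f2. True} \<union>
     {mu_l f * t_el i j - t_el i j * mu_l (mero_shift i f) | f i j. True} \<union>
     {mu_r f * t_el i j - t_el i j * mu_r (mero_shift j f) | f i j. True} \<union>
     {mu_r (hm l k m) * t_el i k * t_el i m - t_el i m * t_el i k | i k m. k < m} \<union>
     {mu_l (hm l j i) * t_el j k * t_el i k - t_el i k * t_el j k | i j k. i < j} \<union>
     {t_el i k * t_el j m
        - (t_el j m * t_el i k + (mu_l (hm l j i) - mu_r (hm l k m)) * t_el j k * t_el i m)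
        | i j k m. i < j \<and> k < m} \<union>
     {mu_r (gm l k m) * t_el i k * t_el j m
        - (mu_l (gm l i j) * t_el j m * t_el i k
           + (mu_r (hm l m k) - mu_l (hm l i j)) * t_el i m * t_el j k)
        | i j k m. i < j \<and> k < m} \<union>
     {(t_el i m * t_el j k - mu_l (hm l j i) * t_el j m * t_el i k)
        - mu_r (- hm l m k) * (t_el i k * t_el j m - mu_l (hm l j i) * t_el j k * t_el i m)
        | i j k m. i < j \<and> k < m}"

definition FR_ideal :: "complex \<Rightarrow> 'n::{finite,linorder} fr_gen free_alg set" where
  "FR_ideal l = ideal_gen (FR_rels l)"


section \<open>Dynamical signs, quantum minors and the determinant\<close>

text \<open>\<open>nth_el I k\<close> is the \<open>k\<close>-th smallest element of \<open>I\<close>, counted from 1.\<close>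

definition nth_el :: "'n::{finite,linorder} set \<Rightarrow> nat \<Rightarrow> 'n" where
  "nth_el I k = sorted_list_of_set I ! (k - 1)"

definition invs :: "nat \<Rightarrow> (nat \<Rightarrow> nat) \<Rightarrow> (nat \<times> nat) set" where
  "invs r \<sigma> = {(k, m). k \<in> {1..r} \<and> m \<in> {1..r} \<and> k < m \<and> \<sigma> k > \<sigma> m}"

definition dyn_S :: "complex \<Rightarrow> (nat \<Rightarrow> nat) \<Rightarrow> 'n::{finite,linorder} set \<Rightarrow> 'n mero" where
  "dyn_S l \<sigma> I = (\<Prod>(k, m)\<in>invs (card I) \<sigma>. - hm l (nth_el I (\<sigma> k)) (nth_el I (\<sigma> m)))"

definition dyn_S_tilde :: "complex \<Rightarrow> (nat \<Rightarrow> nat) \<Rightarrow> 'n::{finite,linorder} set \<Rightarrow> 'n mero" where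
  "dyn_S_tilde l \<sigma> I = (\<Prod>(k, m)\<in>invs (card I) \<sigma>. - hm l (nth_el I (\<sigma> m)) (nth_el I (\<sigma> k)))"

text \<open>The minor is written with \<open>\<rho> = id\<close>, for which \<open>S(\<rho>, J) = 1\<close>.\<close>

definition minor ::
  "complex \<Rightarrow> 'n::{finite,linorder} set \<Rightarrow> 'n set \<Rightarrow> 'n fr_gen free_alg" where
  "minor l I J =
     (\<Sum>\<sigma> | \<sigma> permutes {1..card I}.
        mu_l (dyn_S l \<sigma> I) *
        prod_list (map (\<lambda>k. t_el (nth_el I (\<sigma> k)) (nth_el J k)) [1..<Suc (card I)]))"

definition det_T :: "complex \<Rightarrow> 'n::{finite,linorder} fr_gen free_alg" where
  "det_T l = minor l UNIV UNIV"


section \<open>The algebra of the generators b\<close>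

text \<open>
  Only the \<open>b\<^sub>j\<^sub>i\<close> with \<open>i < j\<close> are generators; the superfluous letters are set to zero.
\<close>

datatype 'n b_gen = GB 'n 'n | Bf "'n mero"

definition b_el :: "'n::finite \<Rightarrow> 'n \<Rightarrow> 'n b_gen free_alg" where "b_el j i = gen (GB j i)"
definition mu_b :: "'n::finite mero \<Rightarrow> 'n b_gen free_alg" where "mu_b f = gen (Bf f)"

definition B_ideal :: "'n::{finite,linorder} b_gen free_alg set" where
  "B_ideal = ideal_gen (mero_rels mu_b \<union> {b_el j i | i j. \<not> i < j})"


section \<open>The tensor product\<close>

text \<open>
  The usual tensor product is the complex vector space on the symbols \<open>x \<otimes> y\<close> modulo
  bilinearity and modulo the ideals of the two factors.  The symbols are multiplied factorwise,
  so before passing to the quotient one works in the monoid algebra on the symbols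
  (again with the monoid written additively).
\<close>

datatype ('a, 'b) tsym = TSym (tfst: 'a) (tsnd: 'b)

instantiation tsym :: (monoid_mult, monoid_mult) monoid_add
begin
definition zero_tsym :: "('a, 'b) tsym" where "zero_tsym = TSym 1 1"
definition plus_tsym :: "('a, 'b) tsym \<Rightarrow> ('a, 'b) tsym \<Rightarrow> ('a, 'b) tsym" where
  "plus_tsym u v = TSym (tfst u * tfst v) (tsnd u * tsnd v)"
instance by standard (auto simp: zero_tsym_def plus_tsym_def mult.assoc)
end

type_synonym 'n tens_alg = "('n b_gen free_alg, 'n fr_gen free_alg) tsym \<Rightarrow>\<^sub>0 complex"

definition tens :: "'n::finite b_gen free_alg \<Rightarrow> 'n fr_gen free_alg \<Rightarrow> 'n tens_alg"
  (infixl \<open>\<otimes>\<^sub>t\<close> 70) where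
  "x \<otimes>\<^sub>t y = Poly_Mapping.single (TSym x y) 1"

lemma tens_mult: "(x \<otimes>\<^sub>t y) * (x' \<otimes>\<^sub>t y') = (x * x') \<otimes>\<^sub>t (y * y')"
  by (simp add: tens_def mult_single plus_tsym_def)

definition tensor_rels :: "complex \<Rightarrow> 'n::{finite,linorder} tens_alg set" where
  "tensor_rels l =
     {(x + x') \<otimes>\<^sub>t y - (x \<otimes>\<^sub>t y + x' \<otimes>\<^sub>t y) | x x' y. True} \<union>
     {x \<otimes>\<^sub>t (y + y') - (x \<otimes>\<^sub>t y + x \<otimes>\<^sub>t y') | x y y'. True} \<union>
     {cscale c x \<otimes>\<^sub>t y - cscale c (x \<otimes>\<^sub>t y) | c x y. True} \<union>
     {x \<otimes>\<^sub>t cscale c y - cscale c (x \<otimes>\<^sub>t y) | c x y. True} \<union>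
     {x \<otimes>\<^sub>t y | x y. x \<in> B_ideal} \<union>
     {x \<otimes>\<^sub>t y | x y. y \<in> FR_ideal l}"

definition balance_rels :: "'n::finite tens_alg set" where
  "balance_rels = {x \<otimes>\<^sub>t (mu_l f * y) - (mu_b f * x) \<otimes>\<^sub>t y | x f y. True}"

text \<open>
  The balancing relations are divided out as a linear subspace, on top of the usual tensor product.
  The two-sided ideal they generate would contain \<open>(f - f') \<otimes> t\<^sub>i\<^sub>j\<close> for every \<open>f\<close>, with \<open>f'\<close> the
  shift of \<open>f\<close>, and would thus kill every \<open>1 \<otimes> t\<^sub>i\<^sub>j\<close>.  Products are therefore formed in the
  usual tensor product, and \<open>bt_class l\<close> is the passage to the quotient.
\<close>

definition bt_null :: "complex \<Rightarrow> 'n::{finite,linorder} tens_alg set" where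
  "bt_null l = cs.span (tensor_rels l \<union> balance_rels)"

definition bt_class :: "complex \<Rightarrow> 'n::{finite,linorder} tens_alg \<Rightarrow> 'n tens_alg set" where
  "bt_class l x = {y. y - x \<in> bt_null l}"

definition bt_act :: "'n::finite mero \<Rightarrow> 'n tens_alg" where
  "bt_act f = 1 \<otimes>\<^sub>t mu_r f"

lemma bt_act_tens: "bt_act f * (x \<otimes>\<^sub>t y) = x \<otimes>\<^sub>t (mu_r f * y)"
  by (simp add: bt_act_def tens_mult)


section \<open>The dynamical quantum Pfaffian\<close>

text \<open>
  The argument \<open>\<iota>\<close> gives the left action of meromorphic functions, as multiplication by \<open>\<iota> f\<close>.
  The factors \<open>x\<^bsub>\<sigma>(2k)\<sigma>(2k-1)\<^esub>\<close> are multiplied in decreasing order of \<open>k\<close>.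
\<close>

definition dyn_Pf ::
  "complex \<Rightarrow> ('n::{finite,linorder} mero \<Rightarrow> 'a::ring_1) \<Rightarrow> ('n \<Rightarrow> 'n \<Rightarrow> 'a) \<Rightarrow> 'a" where
  "dyn_Pf l \<iota> x =
     (\<Sum>\<sigma> | \<sigma> permutes {1..CARD('n)} \<and> (\<forall>k\<in>{1..CARD('n) div 2}. \<sigma> (2 * k - 1) < \<sigma> (2 * k)).
        \<iota> (dyn_S_tilde l \<sigma> UNIV) *
        prod_list (map (\<lambda>k. x (nth_el UNIV (\<sigma> (2 * k))) (nth_el UNIV (\<sigma> (2 * k - 1))))
                       (rev [1..<Suc (CARD('n) div 2)])))"

definition c_el :: "complex \<Rightarrow> 'n::{finite,linorder} \<Rightarrow> 'n \<Rightarrow> 'n tens_alg" where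
  "c_el l j i = (\<Sum>(k, m) | k < m. b_el m k \<otimes>\<^sub>t minor l {k, m} {i, j})"

end

theory Submission
  imports Defs "HOL-Combinatorics.Multiset_Permutations"
begin

text \<open>
  Expanding every \<open>c\<^sub>j\<^sub>i\<close> reduces the theorem to a Laplace expansion: for fixed pairs of rows
  \<open>(k\<^sub>n, m\<^sub>n), \<dots>, (k\<^sub>1, m\<^sub>1)\<close>, the sum of the products of the 2 x 2 minors with these rows, over all
  partitions of the columns into ordered pairs, is \<open>\<mu>\<^sub>l\<close> of the dynamical sign of the rows times the
  determinant if all rows are distinct, and 0 otherwise; the balancing relation then moves this sign
  to the factors \<open>b\<close>.  Written with antisymmetrised columns, a 2 x 2 minor is
  \<open>t\<^sub>m\<^sub>j t\<^sub>k\<^sub>i - h (\<mu>\<^sub>i - \<mu>\<^sub>j) t\<^sub>m\<^sub>i t\<^sub>k\<^sub>j\<close>, so the sum is a column-antisymmetrised product of length \<open>2n\<close>.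
  Under exchange of two neighbouring rows it picks up a dynamical sign, because
  \<open>h x + h (- x) = q + 1 / q\<close>, and it vanishes if they are equal.

  For the rows in decreasing order this product is the determinant: the double sum antisymmetrised in
  both the rows and the columns is the determinant times \<open>\<Sum>\<^sub>\<tau> \<Prod>\<^sub>k\<^sub><\<^sub>m - h (\<lambda>\<^sub>\<tau>\<^sub>k - \<lambda>\<^sub>\<tau>\<^sub>m)\<close> on the one
  hand, and the column-antisymmetrised product times the same sum on the other.  By Lagrange
  interpolation in \<open>u\<^sub>i = q powr (- 2 \<lambda>\<^sub>i)\<close> the sum is, up to sign, the quantum factorial of \<open>2n\<close>,
  a nonzero constant since \<open>q\<close> is not a root of unity.
\<close>


section \<open>Products over the pairs of entries of a list\<close>

fun pairprod :: "('b \<Rightarrow> 'b \<Rightarrow> 'c::comm_monoid_mult) \<Rightarrow> 'b list \<Rightarrow> 'c" where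
  "pairprod \<phi> [] = 1"
| "pairprod \<phi> (x # xs) = prod_list (map (\<phi> x) xs) * pairprod \<phi> xs"

lemma prod_list_map_mult:
  fixes f g :: "'b \<Rightarrow> 'c::comm_monoid_mult"
  shows "prod_list (map (\<lambda>x. f x * g x) xs) = prod_list (map f xs) * prod_list (map g xs)"
  by (induction xs) (simp_all add: mult_ac)

lemma prod_list_map_rev:
  fixes f :: "'b \<Rightarrow> 'c::comm_monoid_mult"
  shows "prod_list (map f (rev xs)) = prod_list (map f xs)"
  by (induction xs) (simp_all add: mult_ac)

lemma pairprod_append:
  "pairprod \<phi> (xs @ ys) =
     pairprod \<phi> xs * pairprod \<phi> ys * prod_list (map (\<lambda>x. prod_list (map (\<phi> x) ys)) xs)"
  by (induction xs) (simp_all add: mult_ac)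

lemma pairprod_rev: "pairprod \<phi> (rev xs) = pairprod (\<lambda>x y. \<phi> y x) xs"
  by (induction xs) (simp_all add: pairprod_append prod_list_map_rev mult_ac)

lemma pairprod_mult: "pairprod (\<lambda>x y. \<phi> x y * \<psi> x y) xs = pairprod \<phi> xs * pairprod \<psi> xs"
  by (induction xs) (simp_all add: prod_list_map_mult mult_ac)

lemma pairprod_cong:
  assumes "distinct xs" "\<And>x y. x \<in> set xs \<Longrightarrow> y \<in> set xs \<Longrightarrow> x \<noteq> y \<Longrightarrow> \<phi> x y = \<psi> x y"
  shows "pairprod \<phi> xs = pairprod \<psi> xs"
  using assms
proof (induction xs)
  case (Cons a xs)
  then have "map (\<phi> a) xs = map (\<psi> a) xs" by auto
  with Cons show ?case by (metis pairprod.simps(2) distinct.simps(2) list.set_intros(2))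
qed simp

text \<open>Only the factor of the exchanged pair changes. The identity is cross-multiplied because
  the values of \<open>\<phi>\<close> need not be invertible.\<close>

lemma pairprod_swap:
  "\<phi> b a * pairprod \<phi> (u @ [a, b] @ v) = \<phi> a b * pairprod \<phi> (u @ [b, a] @ v)"
  by (simp add: pairprod_append prod_list_map_mult mult_ac)

text \<open>Connects the recursion on lists with products over pairs of positions, the form in which
  dynamical signs are given.\<close>

lemma pairprod_map_upt:
  "pairprod \<phi> (map f [a..<b]) = (\<Prod>(i, j) | a \<le> i \<and> i < j \<and> j < b. \<phi> (f i) (f j))"
proof (induction b)
  case (Suc b)
  show ?case
  proof (cases "a \<le> b")
    case True
    have fin: "finite {(i, j). a \<le> i \<and> i < j \<and> j < b}"
      by (rule finite_subset[of _ "{..<b} \<times> {..<b}"]) auto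
    have eq: "{(i, j). a \<le> i \<and> i < j \<and> j < Suc b} =
        {(i, j). a \<le> i \<and> i < j \<and> j < b} \<union> (\<lambda>i. (i, b)) ` {a..<b}"
      using True by auto
    have "(\<Prod>(i, j) | a \<le> i \<and> i < j \<and> j < Suc b. \<phi> (f i) (f j)) =
        (\<Prod>(i, j) | a \<le> i \<and> i < j \<and> j < b. \<phi> (f i) (f j)) * (\<Prod>i\<in>{a..<b}. \<phi> (f i) (f b))"
      unfolding eq by (subst prod.union_disjoint[OF fin]) (auto simp: prod.reindex inj_on_def)
    also have "(\<Prod>i\<in>{a..<b}. \<phi> (f i) (f b)) = prod_list (map (\<lambda>i. \<phi> (f i) (f b)) [a..<b])"
      by (metis atLeastLessThan_upt distinct_upt prod.distinct_set_conv_list)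
    finally show ?thesis using True Suc by (simp add: pairprod_append o_def)
  next
    case False
    then have "{(i, j). a \<le> i \<and> i < j \<and> j < Suc b} = {}" "[a..<Suc b] = []" by auto
    then show ?thesis by (simp only: list.map pairprod.simps prod.empty)
  qed
qed simp


section \<open>Computation modulo a two-sided ideal\<close>

text \<open>No quotient algebra is formed: equality in a presented algebra is congruence of
  representatives in the free algebra.\<close>

locale two_sided_ideal =
  fixes I :: "'a::ring_1 set"
  assumes zero_in: "0 \<in> I"
    and add_in: "x \<in> I \<Longrightarrow> y \<in> I \<Longrightarrow> x + y \<in> I"
    and mult_left_in: "x \<in> I \<Longrightarrow> a * x \<in> I"
    and mult_right_in: "x \<in> I \<Longrightarrow> x * a \<in> I"
begin

definition cong :: "'a \<Rightarrow> 'a \<Rightarrow> bool" (infix \<open>\<doteq>\<close> 50) where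
  "x \<doteq> y \<longleftrightarrow> x - y \<in> I"

lemma uminus_in: "x \<in> I \<Longrightarrow> - x \<in> I"
  using mult_left_in[of x "- 1"] by simp

lemma cong_refl [simp, intro]: "x \<doteq> x"
  by (simp add: cong_def zero_in)

lemma cong_sym: "x \<doteq> y \<Longrightarrow> y \<doteq> x"
  using uminus_in[of "x - y"] by (simp add: cong_def)

lemma cong_trans [trans]: "x \<doteq> y \<Longrightarrow> y \<doteq> z \<Longrightarrow> x \<doteq> z"
  using add_in[of "x - y" "y - z"] by (simp add: cong_def)

lemma cong_eq_trans [trans]: "x \<doteq> y \<Longrightarrow> y = z \<Longrightarrow> x \<doteq> z"
  and eq_cong_trans [trans]: "x = y \<Longrightarrow> y \<doteq> z \<Longrightarrow> x \<doteq> z"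
  by simp_all

lemma cong_add: "x \<doteq> x' \<Longrightarrow> y \<doteq> y' \<Longrightarrow> x + y \<doteq> x' + y'"
  using add_in[of "x - x'" "y - y'"] by (simp add: cong_def algebra_simps)

lemma cong_uminus: "x \<doteq> x' \<Longrightarrow> - x \<doteq> - x'"
  using uminus_in[of "x - x'"] by (simp add: cong_def)

lemma cong_diff: "x \<doteq> x' \<Longrightarrow> y \<doteq> y' \<Longrightarrow> x - y \<doteq> x' - y'"
  using cong_add[of x x' "- y" "- y'"] cong_uminus by simp

lemma cong_mult: "x \<doteq> x' \<Longrightarrow> y \<doteq> y' \<Longrightarrow> x * y \<doteq> x' * y'"
proof -
  assume "x \<doteq> x'" "y \<doteq> y'"
  then have "(x - x') * y + x' * (y - y') \<in> I"
    unfolding cong_def by (intro add_in mult_left_in mult_right_in)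
  then show ?thesis by (simp add: cong_def algebra_simps)
qed

lemma cong_mult_left: "y \<doteq> y' \<Longrightarrow> x * y \<doteq> x * y'"
  and cong_mult_right: "x \<doteq> x' \<Longrightarrow> x * y \<doteq> x' * y"
  by (auto intro: cong_mult)

lemma cong_sum: "(\<And>x. x \<in> A \<Longrightarrow> f x \<doteq> g x) \<Longrightarrow> sum f A \<doteq> sum g A"
  by (induction A rule: infinite_finite_induct) (auto intro: cong_add)

end

text \<open>The embeddings of the meromorphic functions send each function to a single generator, so
  they respect sums and products only modulo the ideal.\<close>

locale ideal_hom = two_sided_ideal I for I :: "'a::ring_1 set" +
  fixes \<nu> :: "'f::comm_ring_1 \<Rightarrow> 'a"
  assumes hom_add: "\<nu> (f + g) \<doteq> \<nu> f + \<nu> g"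
    and hom_mult: "\<nu> (f * g) \<doteq> \<nu> f * \<nu> g"
    and hom_one: "\<nu> 1 \<doteq> 1"
begin

lemma hom_zero: "\<nu> 0 \<doteq> 0"
proof -
  have "\<nu> (0 + 0) - \<nu> 0 \<doteq> \<nu> 0 + \<nu> 0 - \<nu> 0" by (intro cong_diff hom_add) auto
  then show ?thesis by (simp add: cong_sym)
qed

lemma hom_uminus: "\<nu> (- f) \<doteq> - \<nu> f"
proof -
  have "\<nu> (- f) = \<nu> (- f) + \<nu> f - \<nu> f" by simp
  also have "\<dots> \<doteq> \<nu> (- f + f) - \<nu> f" by (intro cong_diff cong_sym[OF hom_add]) auto
  also have "\<dots> \<doteq> 0 - \<nu> f" using hom_zero by (intro cong_diff) auto
  finally show ?thesis by simp
qed

lemma hom_sum: "\<nu> (sum f A) \<doteq> (\<Sum>x\<in>A. \<nu> (f x))"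
proof (induction A rule: infinite_finite_induct)
  case (insert x A)
  then have "\<nu> (sum f (insert x A)) \<doteq> \<nu> (f x) + \<nu> (sum f A)" by (simp add: hom_add)
  also have "\<dots> \<doteq> \<nu> (f x) + (\<Sum>x\<in>A. \<nu> (f x))" by (intro cong_add insert) auto
  finally show ?case using insert by simp
qed (simp_all add: hom_zero)

end


section \<open>Antisymmetrised products\<close>

lemma take_two_nth_drop:
  assumes "Suc p < length xs"
  shows "take p xs @ [xs ! p, xs ! Suc p] @ drop (p + 2) xs = xs"
  using assms id_take_nth_drop[of p xs] Cons_nth_drop_Suc[of "Suc p" xs] by simp

text \<open>For \<open>\<nu> = mu_l\<close> and \<open>x1 < x2\<close> this represents the quantum
  minor on the rows \<open>x1, x2\<close> with its columns taken in the order
  \<open>y1, y2\<close>.\<close>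

definition quad ::
  "('f \<Rightarrow> 'a::ring_1) \<Rightarrow> ('n \<Rightarrow> 'n \<Rightarrow> 'f::comm_ring_1) \<Rightarrow> ('n \<Rightarrow> 'n \<Rightarrow> 'a) \<Rightarrow> 'n \<Rightarrow> 'n \<Rightarrow> 'n \<Rightarrow> 'n \<Rightarrow> 'a"
  where "quad \<nu> h t x1 x2 y1 y2 = t x1 y1 * t x2 y2 + \<nu> (- h x2 x1) * (t x2 y1 * t x1 y2)"

text \<open>Moving a function leftwards across a generator undoes a shift.\<close>

lift_definition mero_shift_inv :: "'n::finite \<Rightarrow> 'n mero \<Rightarrow> 'n mero" is
  "\<lambda>i f x. f (x + - axis i 1)"
  by (elim conjE, intro conjI merom_shift agree_shift)

lemma mero_shift_shift_inv: "mero_shift i (mero_shift_inv i f) = f"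
  by transfer (auto simp: algebra_simps)

definition mon :: "('b \<Rightarrow> 'c \<Rightarrow> 'a::monoid_mult) \<Rightarrow> 'b list \<Rightarrow> 'c list \<Rightarrow> 'a" where
  "mon t xs ys = prod_list (map2 t xs ys)"

lemma mon_simps [simp]:
  "mon t [] [] = 1" "mon t (x # xs) (y # ys) = t x y * mon t xs ys"
  by (simp_all add: mon_def)

lemma mon_append:
  "length xs = length ys \<Longrightarrow> mon t (xs @ xs') (ys @ ys') = mon t xs ys * mon t xs' ys'"
  by (simp add: mon_def)

lemma mon_flip: "length xs = length ys \<Longrightarrow> mon (\<lambda>x y. t y x) xs ys = mon t ys xs"
  by (induction xs ys rule: list_induct2) auto

text \<open>Multiplied over all pairs of a list, these weights give the dynamical signs:
  \<open>S\<close> if \<open>P x y\<close> means \<open>y < x\<close>, and \<open>S\<close> tilde,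
  on the reversed list, if \<open>P\<close> is \<open>(<)\<close>.\<close>

definition wt :: "('n \<Rightarrow> 'n \<Rightarrow> bool) \<Rightarrow> ('n \<Rightarrow> 'n \<Rightarrow> 'f::comm_ring_1) \<Rightarrow> 'n \<Rightarrow> 'n \<Rightarrow> 'f" where
  "wt P h x y = (if P x y then - h x y else 1)"

text \<open>
  Both the rows and the columns of a quantum minor can be antisymmetrised; \<open>t x y\<close> stands for
  \<open>t\<^sub>x\<^sub>y\<close> with \<open>\<nu> = \<mu>\<^sub>l\<close> in the first case and for \<open>t\<^sub>y\<^sub>x\<close> with \<open>\<nu> = \<mu>\<^sub>r\<close> in the second.
  The relation \<open>P x y\<close> says that the entries \<open>x, y\<close> form an inversion when they occur in this order.
\<close>

locale dyn_antisym = two_sided_ideal I + left: ideal_hom I \<nu> + right: ideal_hom I \<nu>'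
  for I :: "'a::ring_1 set" and \<nu> \<nu>' :: "'n::finite mero \<Rightarrow> 'a" +
  fixes t :: "'n \<Rightarrow> 'n \<Rightarrow> 'a" and h :: "'n \<Rightarrow> 'n \<Rightarrow> 'n mero" and P :: "'n \<Rightarrow> 'n \<Rightarrow> bool"
  assumes commute: "\<nu> f * \<nu>' g \<doteq> \<nu>' g * \<nu> f"
    and shift_left: "\<nu> f * t x y \<doteq> t x y * \<nu> (mero_shift x f)"
    and shift_right: "\<nu>' f * t x y \<doteq> t x y * \<nu>' (mero_shift y f)"
    and h_shift: "i \<noteq> j \<Longrightarrow> i \<noteq> k \<Longrightarrow> mero_shift i (h j k) = h j k"
    and P_asym: "P x y \<Longrightarrow> \<not> P y x"
    and P_total: "x \<noteq> y \<Longrightarrow> P x y \<or> P y x"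
    and P_trans: "P x y \<Longrightarrow> P y z \<Longrightarrow> P x z"
    and quad_swap: "P x2 x1 \<Longrightarrow> P y2 y1 \<Longrightarrow>
          quad \<nu> h t x1 x2 y2 y1 \<doteq> \<nu>' (- h y2 y1) * quad \<nu> h t x1 x2 y1 y2"
    and quad_same: "P x2 x1 \<Longrightarrow> quad \<nu> h t x1 x2 y y \<doteq> 0"
begin

abbreviation perms :: "'n list set" where
  "perms \<equiv> permutations_of_set UNIV"

text \<open>Only \<open>xs\<close> is restricted to arrangements of all indices; \<open>ys\<close>
  may have repeated entries, as happens for products of minors whose rows overlap.\<close>

definition Phi :: "'n list \<Rightarrow> 'a" where
  "Phi ys = (\<Sum>xs\<in>perms. \<nu> (pairprod (wt P h) xs) * mon t xs ys)"

lemma mero_shift_uminus: "mero_shift i (- f) = - mero_shift i f"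
  by transfer (auto intro: merom_uminus merom_shift)

lemma left_mon:
  "length xs = length ys \<Longrightarrow> (\<And>x. x \<in> set xs \<Longrightarrow> mero_shift x f = f) \<Longrightarrow>
     \<nu> f * mon t xs ys \<doteq> mon t xs ys * \<nu> f"
proof (induction xs ys rule: list_induct2)
  case (Cons x xs y ys)
  have "\<nu> f * (t x y * mon t xs ys) = \<nu> f * t x y * mon t xs ys" by (simp add: mult.assoc)
  also have "\<dots> \<doteq> t x y * \<nu> f * mon t xs ys"
    using cong_mult_right[OF shift_left[of f x y]] Cons by simp
  also have "\<dots> = t x y * (\<nu> f * mon t xs ys)" by (simp add: mult.assoc)
  also have "\<dots> \<doteq> t x y * (mon t xs ys * \<nu> f)" using Cons by (intro cong_mult_left) auto
  finally show ?case by (simp add: mult.assoc)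
qed simp

text \<open>The function \<open>g\<close> arises from \<open>f\<close> by undoing the shifts by the
  entries of \<open>ys\<close>. It does not depend on \<open>xs\<close>, so it can be taken out of a
  sum over \<open>xs\<close>.\<close>

lemma right_mon_ex:
  "\<exists>g. ((\<forall>y\<in>set ys. mero_shift y f = f) \<longrightarrow> g = f) \<and>
       (\<forall>xs. length xs = length ys \<longrightarrow> mon t xs ys * \<nu>' f \<doteq> \<nu>' g * mon t xs ys)"
proof (induction ys)
  case (Cons y ys)
  then obtain g where g: "(\<forall>y\<in>set ys. mero_shift y f = f) \<longrightarrow> g = f"
    "\<And>xs. length xs = length ys \<Longrightarrow> mon t xs ys * \<nu>' f \<doteq> \<nu>' g * mon t xs ys" by blast
  \<comment> \<open>If \<open>g\<close> is invariant under the shift, \<open>g\<close> itself is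
    chosen, otherwise its inverse shift.\<close>
  obtain g' where g': "mero_shift y g' = g" "mero_shift y g = g \<Longrightarrow> g' = g"
    by (metis mero_shift_shift_inv)
  have "mon t xs (y # ys) * \<nu>' f \<doteq> \<nu>' g' * mon t xs (y # ys)"
    if "length xs = length (y # ys)" for xs
  proof -
    from that obtain x zs where xs: "xs = x # zs" "length zs = length ys" by (cases xs) auto
    have "mon t xs (y # ys) * \<nu>' f = t x y * (mon t zs ys * \<nu>' f)" by (simp add: xs mult.assoc)
    also have "\<dots> \<doteq> t x y * (\<nu>' g * mon t zs ys)" by (intro cong_mult_left g xs)
    also have "\<dots> = t x y * \<nu>' (mero_shift y g') * mon t zs ys" by (simp add: g' mult.assoc)
    also have "\<dots> \<doteq> \<nu>' g' * t x y * mon t zs ys"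
      by (intro cong_mult_right cong_sym[OF shift_right])
    finally show ?thesis by (simp add: xs mult.assoc)
  qed
  moreover have "(\<forall>y\<in>set (y # ys). mero_shift y f = f) \<longrightarrow> g' = f" using g g' by auto
  ultimately show ?case by blast
qed auto

text \<open>Each \<open>xs\<close> is matched with the list in which the two entries facing
  \<open>y1, y2\<close> are exchanged. Of the two lists the one without an inversion at this place
  is kept, and the two monomials combine to a \<open>quad\<close>.\<close>

lemma Phi_pair:
  assumes len: "length (u @ [y1, y2] @ v) = CARD('n)"
  shows "Phi (u @ [y1, y2] @ v) \<doteq>
    (\<Sum>xs | xs \<in> perms \<and> P (xs ! Suc (length u)) (xs ! length u).
       \<nu> (pairprod (wt P h) xs) *
         (mon t (take (length u) xs) u *
            quad \<nu> h t (xs ! length u) (xs ! Suc (length u)) y1 y2 *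
          mon t (drop (length u + 2) xs) v))"
    (is "_ \<doteq> sum ?T ?G")
proof -
  define p where "p = length u"
  define F where "F = (\<lambda>xs. \<nu> (pairprod (wt P h) xs) * mon t xs (u @ [y1, y2] @ v))"
  define sw where "sw = (\<lambda>xs::'n list. take p xs @ [xs ! Suc p, xs ! p] @ drop (p + 2) xs)"
  let ?B = "{xs. xs \<in> perms \<and> P (xs ! p) (xs ! Suc p)}"
  have dec: "\<exists>a x1 x2 b. xs = a @ [x1, x2] @ b \<and> length a = p \<and> x1 = xs ! p \<and> x2 = xs ! Suc p \<and>
      length b = length v \<and> b = drop (p + 2) xs \<and> a = take p xs \<and> x1 \<notin> set a \<and> x2 \<notin> set a \<and> x1 \<noteq> x2"
    if "xs \<in> perms" for xs
  proof -
    have l: "length xs = CARD('n)" using that length_finite_permutations_of_set by blast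
    then have eq: "take p xs @ [xs ! p, xs ! Suc p] @ drop (p + 2) xs = xs"
      using take_two_nth_drop[of p xs] len by (simp add: p_def)
    have "distinct (take p xs @ [xs ! p, xs ! Suc p] @ drop (p + 2) xs)"
      unfolding eq using that permutations_of_setD by blast
    moreover have "length (take p xs) = p" "length (drop (p + 2) xs) = length v"
      using l len by (auto simp: p_def)
    ultimately show ?thesis
      by (intro exI[of _ "take p xs"] exI[of _ "xs ! p"] exI[of _ "xs ! Suc p"]
          exI[of _ "drop (p + 2) xs"] conjI eq[symmetric] refl) auto
  qed
  have sw_eq: "sw (a @ [x1, x2] @ b) = a @ [x2, x1] @ b" if "length a = p" for a x1 x2 b
    using that by (simp add: sw_def nth_append)
  have sw: "sw xs \<in> perms" "sw (sw xs) = xs" "sw xs ! p = xs ! Suc p" "sw xs ! Suc p = xs ! p"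
    if xs: "xs \<in> perms" for xs
  proof -
    obtain a x1 x2 b where d: "xs = a @ [x1, x2] @ b" "length a = p"
      using dec[OF xs] by (elim exE conjE) (rule that)
    show "sw xs \<in> perms" using xs unfolding d(1) sw_eq[OF d(2)]
      by (auto simp: permutations_of_set_def)
    show "sw (sw xs) = xs" unfolding d(1) sw_eq[OF d(2)] ..
    show "sw xs ! p = xs ! Suc p" "sw xs ! Suc p = xs ! p"
      unfolding d(1) sw_eq[OF d(2)] using d(2) by (auto simp: nth_append)
  qed
  have neq: "xs ! p \<noteq> xs ! Suc p" if "xs \<in> perms" for xs
    using dec[OF that] by (elim exE conjE) simp
  have perms: "perms = ?G \<union> ?B" "?G \<inter> ?B = {}"
    using P_total neq P_asym by (auto simp: p_def)
  have fin: "finite ?G" "finite ?B" by (rule finite_subset[of _ perms]; auto)+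
  have "Phi (u @ [y1, y2] @ v) = sum F ?G + sum F ?B"
    unfolding Phi_def F_def[symmetric] using sum.union_disjoint[OF fin perms(2), of F]
    by (simp only: perms(1)[symmetric])
  also have "sum F ?B = (\<Sum>xs\<in>?G. F (sw xs))"
    by (rule sum.reindex_bij_witness[of _ sw sw]) (auto simp: sw p_def[symmetric])
  also have "sum F ?G + (\<Sum>xs\<in>?G. F (sw xs)) = (\<Sum>xs\<in>?G. F xs + F (sw xs))"
    by (simp add: sum.distrib)
  also have "\<dots> \<doteq> sum ?T ?G"
  proof (rule cong_sum)
    fix xs assume xs: "xs \<in> ?G"
    then have xsp: "xs \<in> perms" by simp
    obtain a x1 x2 b where d: "xs = a @ [x1, x2] @ b" "length a = p" "x1 = xs ! p"
      "x2 = xs ! Suc p" "length b = length v" "b = drop (p + 2) xs" "a = take p xs"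
      "x1 \<notin> set a" "x2 \<notin> set a" "x1 \<noteq> x2" using dec[OF xsp] by (elim exE conjE) (rule that)
    have P: "P x2 x1" "\<not> P x1 x2" using xs P_asym d(3,4) by (auto simp: p_def)
    let ?w = "pairprod (wt P h) xs"
    have la: "length a = length u" using d(2) p_def by simp
    \<comment> \<open>The exchange creates a single new inversion, whose weight is the coefficient
      in \<open>quad\<close>.\<close>
    have w: "pairprod (wt P h) (sw xs) = ?w * (- h x2 x1)"
      using pairprod_swap[of "wt P h" x1 x2 a b] P unfolding d(1) sw_eq[OF d(2)]
      by (simp add: wt_def mult.commute)
    have m: "mon t (a @ [x, x'] @ b) (u @ [y1, y2] @ v) = mon t a u * (t x y1 * t x' y2) * mon t b v"
      for x x' using la d(5) by (simp add: mon_append mult.assoc)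
    have "F (sw xs) = \<nu> (?w * (- h x2 x1)) * (mon t a u * (t x2 y1 * t x1 y2) * mon t b v)"
      unfolding F_def w unfolding d(1) sw_eq[OF d(2)] m ..
    also have "\<dots> \<doteq> \<nu> ?w * \<nu> (- h x2 x1) * (mon t a u * (t x2 y1 * t x1 y2) * mon t b v)"
      by (intro cong_mult_right left.hom_mult)
    also have "\<dots> = \<nu> ?w * (\<nu> (- h x2 x1) * mon t a u * (t x2 y1 * t x1 y2) * mon t b v)"
      by (simp add: mult.assoc)
    \<comment> \<open>The entries of \<open>a\<close> differ from \<open>x1\<close> and
      \<open>x2\<close>, so their shifts fix \<open>h x2 x1\<close>.\<close>
    also have "\<dots> \<doteq> \<nu> ?w * (mon t a u * \<nu> (- h x2 x1) * (t x2 y1 * t x1 y2) * mon t b v)"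
      using d(8,9) la
      by (intro cong_mult_left cong_mult_right left_mon) (auto simp: mero_shift_uminus intro!: h_shift)
    finally have 1: "F (sw xs) \<doteq>
      \<nu> ?w * (mon t a u * \<nu> (- h x2 x1) * (t x2 y1 * t x1 y2) * mon t b v)" .
    have 2: "F xs = \<nu> ?w * (mon t a u * (t x1 y1 * t x2 y2) * mon t b v)"
      unfolding F_def by (subst (2) d(1)) (simp only: m)
    have "F xs + F (sw xs) \<doteq> \<nu> ?w * (mon t a u * (t x1 y1 * t x2 y2) * mon t b v) +
        \<nu> ?w * (mon t a u * \<nu> (- h x2 x1) * (t x2 y1 * t x1 y2) * mon t b v)"
      unfolding 2 by (intro cong_add 1 cong_refl)
    also have "\<dots> = \<nu> ?w * (mon t a u * quad \<nu> h t x1 x2 y1 y2 * mon t b v)"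
      by (simp add: quad_def algebra_simps)
    also have "\<dots> = ?T xs" using d(3,4,6,7) by (simp add: p_def)
    finally show "F xs + F (sw xs) \<doteq> ?T xs" .
  qed
  finally show ?thesis .
qed

lemma Phi_same:
  assumes "length (u @ [y, y] @ v) = CARD('n)"
  shows "Phi (u @ [y, y] @ v) \<doteq> 0"
proof -
  note Phi_pair[OF assms]
  also have "(\<Sum>xs | xs \<in> perms \<and> P (xs ! Suc (length u)) (xs ! length u).
       \<nu> (pairprod (wt P h) xs) *
         (mon t (take (length u) xs) u *
            quad \<nu> h t (xs ! length u) (xs ! Suc (length u)) y y *
          mon t (drop (length u + 2) xs) v)) \<doteq>
      (\<Sum>xs | xs \<in> perms \<and> P (xs ! Suc (length u)) (xs ! length u).
       \<nu> (pairprod (wt P h) xs) *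
         (mon t (take (length u) xs) u * 0 * mon t (drop (length u + 2) xs) v))"
    by (intro cong_sum cong_mult_left cong_mult_right quad_same) auto
  finally show ?thesis by simp
qed

text \<open>The factor from \<open>quad_swap\<close> stands to the right of the monomial facing
  \<open>u\<close> and is shifted when it is moved to the front. If \<open>u\<close> contains
  \<open>y1\<close> or \<open>y2\<close>, only the existence of \<open>g\<close> is recorded; this
  suffices for showing that products with repeated entries vanish.\<close>

lemma Phi_swap:
  assumes len: "length (u @ [y2, y1] @ v) = CARD('n)" and P: "P y2 y1"
  shows "\<exists>g. (y1 \<notin> set u \<and> y2 \<notin> set u \<longrightarrow> g = - h y2 y1) \<and>
             Phi (u @ [y2, y1] @ v) \<doteq> \<nu>' g * Phi (u @ [y1, y2] @ v)"
proof -
  let ?G = "{xs. xs \<in> perms \<and> P (xs ! Suc (length u)) (xs ! length u)}"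
  let ?w = "\<lambda>xs. pairprod (wt P h) xs"
  let ?a = "\<lambda>xs. mon t (take (length u) xs) u" and ?b = "\<lambda>xs. mon t (drop (length u + 2) xs) v"
  let ?q = "\<lambda>xs. quad \<nu> h t (xs ! length u) (xs ! Suc (length u))"
  obtain g where g: "(\<forall>y\<in>set u. mero_shift y (- h y2 y1) = - h y2 y1) \<longrightarrow> g = - h y2 y1"
    "\<And>xs. length xs = length u \<Longrightarrow> mon t xs u * \<nu>' (- h y2 y1) \<doteq> \<nu>' g * mon t xs u"
    using right_mon_ex by blast
  have "Phi (u @ [y2, y1] @ v) \<doteq> (\<Sum>xs\<in>?G. \<nu> (?w xs) * (?a xs * ?q xs y2 y1 * ?b xs))"
    by (rule Phi_pair[OF len])
  also have "\<dots> \<doteq> (\<Sum>xs\<in>?G. \<nu>' g * (\<nu> (?w xs) * (?a xs * ?q xs y1 y2 * ?b xs)))"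
  proof (rule cong_sum)
    fix xs assume xs: "xs \<in> ?G"
    then have "length xs = CARD('n)" using length_finite_permutations_of_set by blast
    then have l: "length (take (length u) xs) = length u" using len by simp
    have "\<nu> (?w xs) * (?a xs * ?q xs y2 y1 * ?b xs) \<doteq>
        \<nu> (?w xs) * (?a xs * (\<nu>' (- h y2 y1) * ?q xs y1 y2) * ?b xs)"
      using xs P by (intro cong_mult_left cong_mult_right quad_swap) auto
    also have "\<dots> = \<nu> (?w xs) * (?a xs * \<nu>' (- h y2 y1) * (?q xs y1 y2 * ?b xs))"
      by (simp add: mult.assoc)
    also have "\<dots> \<doteq> \<nu> (?w xs) * (\<nu>' g * ?a xs * (?q xs y1 y2 * ?b xs))"
      by (intro cong_mult_left cong_mult_right g l)
    also have "\<dots> = \<nu> (?w xs) * \<nu>' g * (?a xs * ?q xs y1 y2 * ?b xs)"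
      by (simp add: mult.assoc)
    also have "\<dots> \<doteq> \<nu>' g * \<nu> (?w xs) * (?a xs * ?q xs y1 y2 * ?b xs)"
      by (intro cong_mult_right commute)
    finally show "\<nu> (?w xs) * (?a xs * ?q xs y2 y1 * ?b xs) \<doteq>
        \<nu>' g * (\<nu> (?w xs) * (?a xs * ?q xs y1 y2 * ?b xs))" by (simp add: mult.assoc)
  qed
  also have "\<dots> = \<nu>' g * (\<Sum>xs\<in>?G. \<nu> (?w xs) * (?a xs * ?q xs y1 y2 * ?b xs))"
    by (simp add: sum_distrib_left)
  also have "\<dots> \<doteq> \<nu>' g * Phi (u @ [y1, y2] @ v)"
    using len by (intro cong_mult_left cong_sym[OF Phi_pair]) simp
  finally have "Phi (u @ [y2, y1] @ v) \<doteq> \<nu>' g * Phi (u @ [y1, y2] @ v)" .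
  moreover have "y1 \<notin> set u \<and> y2 \<notin> set u \<longrightarrow> g = - h y2 y1"
    using g(1) h_shift mero_shift_uminus by metis
  ultimately show ?thesis by blast
qed

text \<open>The termination measure for sorting by adjacent exchanges.\<close>

fun inv_count :: "'n list \<Rightarrow> nat" where
  "inv_count [] = 0"
| "inv_count (x # xs) = length (filter (P x) xs) + inv_count xs"

lemma inv_count_swap:
  "P a b \<Longrightarrow> inv_count (u @ [a, b] @ v) = Suc (inv_count (u @ [b, a] @ v))"
  using P_asym by (induction u) auto

text \<open>As \<open>P\<close> is a strict total order, its negation is transitive, so sortedness
  is decided by neighbouring entries.\<close>

lemma exists_adjacent_inversion:
  assumes "\<not> sorted_wrt (\<lambda>a b. \<not> P a b) ys"
  shows "\<exists>u a b v. ys = u @ [a, b] @ v \<and> P a b"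
proof -
  have "transp (\<lambda>a b. \<not> P a b)"
  proof (rule transpI, rule notI)
    fix x y z assume xyz: "\<not> P x y" "\<not> P y z" "P x z"
    show False
    proof (cases "x = y")
      case False
      then have "P y x" using P_total[of x y] xyz(1) by simp
      then show False using P_trans[of y x z] xyz by simp
    qed (use xyz in simp)
  qed
  then obtain i where i: "Suc i < length ys" "P (ys ! i) (ys ! Suc i)"
    using assms by (auto simp: sorted_wrt_iff_nth_Suc_transp)
  show ?thesis
    by (intro exI conjI) (rule take_two_nth_drop[OF i(1), symmetric], rule i(2))
qed

text \<open>If the head of the list recurs, totality of \<open>P\<close> forces the entry right
  after it to be equal to it.\<close>

lemma sorted_not_distinct:
  assumes "sorted_wrt (\<lambda>a b. \<not> P a b) ys" "\<not> distinct ys"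
  shows "\<exists>u a v. ys = u @ [a, a] @ v"
  using assms
proof (induction ys)
  case (Cons x xs)
  show ?case
  proof (cases "distinct xs")
    case True
    with Cons obtain z zs where xs: "xs = z # zs" "x \<in> set xs" by (cases xs) auto
    have "z = x"
    proof (rule ccontr)
      assume "z \<noteq> x"
      with xs have "x \<in> set zs" "\<not> P x z" using Cons by auto
      then show False using Cons.prems(1) xs P_total[OF \<open>z \<noteq> x\<close>] by auto
    qed
    then show ?thesis using xs by (intro exI[of _ "[]"]) auto
  next
    case False
    with Cons obtain u a v where "xs = u @ [a, a] @ v" by auto
    then show ?thesis by (intro exI[of _ "x # u"]) auto
  qed
qed simp

text \<open>Bubble sort: each exchange removes one inversion and contributes its weight. A sorted
  list is either \<open>y0\<close> or has two equal neighbours, and then \<open>Phi_same\<close>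
  applies.\<close>

lemma Phi_reorder:
  assumes "length ys = CARD('n)"
    and y0: "\<And>zs. sorted_wrt (\<lambda>a b. \<not> P a b) zs \<Longrightarrow> distinct zs \<Longrightarrow> set zs = UNIV \<Longrightarrow> zs = y0"
  shows "Phi ys \<doteq> (if distinct ys then \<nu>' (pairprod (wt P h) ys) * Phi y0 else 0)"
  using assms(1)
proof (induction "inv_count ys" arbitrary: ys rule: less_induct)
  case less
  show ?case
  proof (cases "sorted_wrt (\<lambda>a b. \<not> P a b) ys")
    case True
    show ?thesis
    proof (cases "distinct ys")
      case d: True
      then have "set ys = UNIV" using less.prems by (metis card_eq_UNIV_imp_eq_UNIV distinct_card finite)
      then have "ys = y0" using y0 True d by blast
      \<comment> \<open>A sorted list has no inversions, so its sign is 1.\<close>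
      have one: "prod_list (map (wt P h x) xs) = 1" if "\<forall>y\<in>set xs. \<not> P x y" for x xs
        using that by (induction xs) (auto simp: wt_def)
      have "pairprod (wt P h) ys = 1" using True by (induction ys) (auto simp: one)
      then have "\<nu>' (pairprod (wt P h) ys) * Phi y0 \<doteq> Phi y0"
        using cong_mult_right[OF right.hom_one, of "Phi y0"] by simp
      then show ?thesis using d \<open>ys = y0\<close> by (simp add: cong_sym)
    next
      case False
      then show ?thesis using sorted_not_distinct[OF True] Phi_same less.prems by auto
    qed
  next
    case False
    then obtain u a b v where ys: "ys = u @ [a, b] @ v" "P a b"
      using exists_adjacent_inversion by blast
    let ?zs = "u @ [b, a] @ v"
    obtain g where g: "b \<notin> set u \<and> a \<notin> set u \<longrightarrow> g = - h a b" "Phi ys \<doteq> \<nu>' g * Phi ?zs"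
      using Phi_swap[of u a b v] less.prems ys by auto
    have IH: "Phi ?zs \<doteq> (if distinct ?zs then \<nu>' (pairprod (wt P h) ?zs) * Phi y0 else 0)"
      by (rule less.hyps) (use less.prems inv_count_swap[OF ys(2), of u v] ys in simp_all)
    have dd: "distinct ys \<longleftrightarrow> distinct ?zs" unfolding ys by auto
    have 1: "Phi ys \<doteq> \<nu>' g * (if distinct ?zs then \<nu>' (pairprod (wt P h) ?zs) * Phi y0 else 0)"
      using g(2) cong_mult_left[OF IH] cong_trans by blast
    show ?thesis
    proof (cases "distinct ys")
      case True
      \<comment> \<open>Without repetitions \<open>a\<close> and \<open>b\<close> do not occur in
        \<open>u\<close>, so \<open>g\<close> is exactly the weight of the removed
        inversion.\<close>
      then have "g = - h a b" using g(1) ys by auto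
      moreover have "pairprod (wt P h) ys = - h a b * pairprod (wt P h) ?zs"
        using pairprod_swap[of "wt P h" b a u v] ys P_asym by (auto simp: wt_def)
      ultimately have "\<nu>' (pairprod (wt P h) ys) \<doteq> \<nu>' g * \<nu>' (pairprod (wt P h) ?zs)"
        by (simp only: right.hom_mult)
      then have "\<nu>' g * (\<nu>' (pairprod (wt P h) ?zs) * Phi y0) \<doteq> \<nu>' (pairprod (wt P h) ys) * Phi y0"
        using cong_mult_right cong_sym by (metis mult.assoc)
      then show ?thesis using 1 True dd cong_trans by auto
    next
      case False
      \<comment> \<open>Here \<open>g\<close> may be a shifted function, but the product it
        multiplies is already congruent to 0.\<close>
      from 1 have "Phi ys \<doteq> \<nu>' g * 0" unfolding if_not_P[OF False[unfolded dd]] .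
      then show ?thesis using False by simp
    qed
  qed
qed

end


section \<open>The symmetrised product of the weights\<close>

lemma coeff_prod_linear:
  fixes a b :: "'b \<Rightarrow> 'c::idom"
  assumes "finite A"
  shows "degree (\<Prod>i\<in>A. [:a i, b i:]) \<le> card A \<and>
         coeff (\<Prod>i\<in>A. [:a i, b i:]) (card A) = (\<Prod>i\<in>A. b i)"
  using assms
proof (induction A rule: finite_induct)
  case (insert x A)
  let ?p = "\<Prod>i\<in>A. [:a i, b i:]"
  have "degree ([:a x, b x:] * ?p) \<le> degree [:a x, b x:] + degree ?p" by (rule degree_mult_le)
  also have "\<dots> \<le> 1 + card A" using insert by (intro add_mono) auto
  finally have "degree ([:a x, b x:] * ?p) \<le> Suc (card A)" by simp
  moreover have "coeff ?p (Suc (card A)) = 0" using insert by (intro coeff_eq_0) auto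
  ultimately show ?case using insert by simp
qed simp

text \<open>Lagrange interpolation at the nodes \<open>u\<^sub>i\<close> of the polynomial \<open>\<Prod>\<^sub>i (q z - u\<^sub>i / q)\<close>, evaluated at 0.\<close>

lemma sum_prod_interpolation:
  fixes u :: "'b \<Rightarrow> complex" and q :: complex
  assumes A: "finite A" "A \<noteq> {}" and inj: "inj_on u A" and u0: "\<And>i. i \<in> A \<Longrightarrow> u i \<noteq> 0"
    and q: "q \<noteq> 0" "q ^ 2 \<noteq> 1"
  shows "(\<Sum>i\<in>A. \<Prod>j\<in>A - {i}. (q * u i - u j / q) / (u i - u j)) =
         (q ^ card A - 1 / q ^ card A) / (q - 1 / q)"
proof -
  define N where "N = card A"
  define S where "S = (\<Sum>i\<in>A. \<Prod>j\<in>A - {i}. (q * u i - u j / q) / (u i - u j))"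
  have N: "N > 0" using A by (simp add: N_def card_gt_0_iff)
  define P where "P = (\<Prod>l\<in>A. [:- u l / q, q:])"
  define L where "L = (\<lambda>i. \<Prod>j\<in>A - {i}. [:- u j, 1:])"
  define d where "d = (\<lambda>i. \<Prod>j\<in>A - {i}. (u i - u j))"
  define M where "M = (\<Prod>l\<in>A. [:- u l, 1:])"
  \<comment> \<open>The degree of \<open>P\<close> equals the number of nodes, one too many for
    plain interpolation. The multiple of \<open>M\<close>, which vanishes at all nodes, supplies the
    leading coefficient.\<close>
  define R where "R = smult (q ^ N) M + (\<Sum>i\<in>A. smult (poly P (u i) / d i) (L i))"
  have d0: "d i \<noteq> 0" if "i \<in> A" for i
    using that A(1) inj by (auto simp: d_def inj_on_def)
  have degL: "degree (L i) < N" if "i \<in> A" for i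
  proof -
    have "degree (L i) \<le> card (A - {i})" unfolding L_def
      using coeff_prod_linear[of "A - {i}" "\<lambda>j. - u j" "\<lambda>_. 1"] A(1) by simp
    also have "\<dots> < N" unfolding N_def using that A(1) by (intro psubset_card_mono) auto
    finally show ?thesis .
  qed
  have L_eval: "poly (L i) (u k) = (if i = k then d i else 0)" if "i \<in> A" "k \<in> A" for i k
    using that A(1) by (auto simp: L_def d_def poly_prod)
  have M_eval: "poly M (u k) = 0" if "k \<in> A" for k
    using that A(1) by (auto simp: M_def poly_prod)
  have degP: "degree P \<le> N" "coeff P N = q ^ N"
    using coeff_prod_linear[OF A(1), of "\<lambda>l. - u l / q" "\<lambda>_. q"] by (auto simp: P_def N_def)
  have degM: "degree M \<le> N" "coeff M N = 1"
    using coeff_prod_linear[OF A(1), of "\<lambda>l. - u l" "\<lambda>_. 1"] by (auto simp: M_def N_def)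
  have "P = R"
  proof (rule poly_eqI_degree_lead_coeff[where n = N and A = "u ` A"])
    show "coeff P N = coeff R N"
      using degL by (simp add: R_def degP degM coeff_sum coeff_eq_0)
    show "N \<le> card (u ` A)" using inj by (simp add: N_def card_image)
    show "degree P \<le> N" by (rule degP)
    have "degree (smult (poly P (u i) / d i) (L i)) \<le> N" if "i \<in> A" for i
      using degL[OF that] degree_smult_le[of "poly P (u i) / d i" "L i"] by linarith
    moreover have "degree (smult (q ^ N) M) \<le> N" using degM degree_smult_le[of "q ^ N" M] by linarith
    ultimately show "degree R \<le> N"
      unfolding R_def using A(1) by (intro degree_add_le degree_sum_le) auto
    fix z assume "z \<in> u ` A"
    then obtain k where k: "k \<in> A" "z = u k" by blast
    have "(\<Sum>i\<in>A. poly P (u i) / d i * poly (L i) (u k)) =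
        (\<Sum>i\<in>A. if i = k then poly P (u k) else 0)"
      using k d0 by (intro sum.cong) (auto simp: L_eval)
    then show "poly P z = poly R z" using k A(1) by (simp add: R_def poly_sum M_eval)
  qed
  then have "poly P 0 = poly R 0" by simp
  also have "poly R 0 = q ^ N * poly M 0 + (\<Sum>i\<in>A. poly P (u i) / d i * poly (L i) 0)"
    by (simp add: R_def poly_sum)
  finally have eq: "poly P 0 = \<dots>" .
  define U where "U = (\<Prod>l\<in>A. - u l)"
  have U0: "U \<noteq> 0" using u0 A(1) by (simp add: U_def)
  have "poly P 0 = (\<Prod>l\<in>A. - u l / q)" by (simp add: P_def poly_prod)
  also have "\<dots> = (\<Prod>l\<in>A. - u l) / (\<Prod>l\<in>A. q)" by (rule prod_dividef)
  finally have "poly P 0 = U / q ^ N" by (simp add: U_def N_def)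
  moreover have "poly M 0 = U" by (simp add: M_def poly_prod U_def)
  moreover have "poly P (u i) / d i * poly (L i) 0 =
      - (q - 1 / q) * U * (\<Prod>j\<in>A - {i}. (q * u i - u j / q) / (u i - u j))" if "i \<in> A" for i
  proof -
    define B where "B = (\<Prod>j\<in>A - {i}. (q * u i - u j / q))"
    \<comment> \<open>The factor of \<open>P\<close> with index \<open>i\<close> becomes
      \<open>(q - 1/q) u i\<close>; the factor \<open>u i\<close> then completes
      \<open>poly (L i) 0\<close> to \<open>- U\<close>.\<close>
    have p: "poly P (u i) = (u i * q - u i / q) * B"
      unfolding P_def poly_prod B_def using that A(1)
      by (subst prod.remove[of _ i]) (auto simp: algebra_simps)
    have U: "U = - u i * poly (L i) 0"
      unfolding U_def L_def poly_prod using that A(1) by (subst prod.remove[of _ i]) auto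
    have b: "(\<Prod>j\<in>A - {i}. (q * u i - u j / q) / (u i - u j)) = B / d i"
      by (simp add: B_def d_def prod_dividef)
    show ?thesis unfolding p b U by (simp add: algebra_simps diff_divide_distrib)
  qed
  ultimately have "U / q ^ N = q ^ N * U + (\<Sum>i\<in>A. - (q - 1 / q) * U *
      (\<Prod>j\<in>A - {i}. (q * u i - u j / q) / (u i - u j)))" using eq by simp
  then have "U / q ^ N = q ^ N * U + - (q - 1 / q) * U * S"
    by (simp only: sum_distrib_left S_def)
  then have "U * (1 / q ^ N) = U * (q ^ N - (q - 1 / q) * S)"
    by (simp only: right_diff_distrib mult_minus_left) (simp add: mult_ac)
  then have "1 / q ^ N = q ^ N - (q - 1 / q) * S" by (rule mult_left_cancel[OF U0, THEN iffD1])
  then have "(q - 1 / q) * S = q ^ N - 1 / q ^ N" by simp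
  moreover have "q - 1 / q \<noteq> 0" using q by (auto simp: field_simps power2_eq_square)
  ultimately have "S = (q ^ N - 1 / q ^ N) / (q - 1 / q)" by (metis nonzero_mult_div_cancel_left)
  then show ?thesis unfolding S_def N_def .
qed

text \<open>The quantum factorial of \<open>r\<close> with the sign
  \<open>(-1)^(r(r-1)/2)\<close>.\<close>

definition sgn_qfact :: "complex \<Rightarrow> nat \<Rightarrow> complex" where
  "sgn_qfact q r = (\<Prod>k=1..r. (- 1) ^ (k - 1) * ((q ^ k - 1 / q ^ k) / (q - 1 / q)))"

text \<open>Split off the first entry \<open>x\<close>. Its factors form a product over
  \<open>A - {x}\<close> that ignores the order of the rest, and by induction the sum over the rest
  depends only on the cardinality. The remaining sum over \<open>x\<close> is
  \<open>sum_prod_interpolation\<close>.\<close>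

lemma sum_permutations_pairprod:
  fixes u :: "'b \<Rightarrow> complex" and q :: complex
  assumes "finite A" and "inj_on u A" and "\<And>i. i \<in> A \<Longrightarrow> u i \<noteq> 0" and q: "q \<noteq> 0" "q ^ 2 \<noteq> 1"
  shows "(\<Sum>xs\<in>permutations_of_set A. pairprod (\<lambda>i j. - ((q * u i - u j / q) / (u i - u j))) xs) =
         sgn_qfact q (card A)"
  using assms(1-3)
proof (induction A rule: finite_psubset_induct)
  case (psubset A)
  let ?\<phi> = "\<lambda>i j. - ((q * u i - u j / q) / (u i - u j))"
  show ?case
  proof (cases "A = {}")
    case False
    then obtain r where r: "card A = Suc r" using psubset(1) by (metis card_gt_0_iff gr0_implies_Suc)
    have inner: "(\<Sum>ys\<in>(#) x ` permutations_of_set (A - {x}). pairprod ?\<phi> ys) =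
        (- 1) ^ r * (\<Prod>j\<in>A - {x}. (q * u x - u j / q) / (u x - u j)) * sgn_qfact q r"
      if x: "x \<in> A" for x
    proof -
      have c: "card (A - {x}) = r" using r x psubset(1) by simp
      have "(\<Sum>ys\<in>(#) x ` permutations_of_set (A - {x}). pairprod ?\<phi> ys) =
          (\<Sum>xs\<in>permutations_of_set (A - {x}). prod_list (map (?\<phi> x) xs) * pairprod ?\<phi> xs)"
        by (subst sum.reindex) auto
      also have "\<dots> = (\<Sum>xs\<in>permutations_of_set (A - {x}). (\<Prod>j\<in>A - {x}. ?\<phi> x j) * pairprod ?\<phi> xs)"
      proof (intro sum.cong refl)
        fix xs assume "xs \<in> permutations_of_set (A - {x})"
        then have "set xs = A - {x}" "distinct xs" by (auto dest: permutations_of_setD)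
        then have "prod_list (map (?\<phi> x) xs) = (\<Prod>j\<in>A - {x}. ?\<phi> x j)"
          using prod.distinct_set_conv_list[of xs "?\<phi> x"] by simp
        then show "prod_list (map (?\<phi> x) xs) * pairprod ?\<phi> xs =
            (\<Prod>j\<in>A - {x}. ?\<phi> x j) * pairprod ?\<phi> xs" by (rule arg_cong)
      qed
      also have "\<dots> = (\<Prod>j\<in>A - {x}. ?\<phi> x j) * sgn_qfact q r"
        using psubset.IH[of "A - {x}"] x psubset.prems c
        by (simp add: sum_distrib_left[symmetric] inj_on_diff psubset_eq) blast
      also have "(\<Prod>j\<in>A - {x}. ?\<phi> x j) =
          (- 1) ^ r * (\<Prod>j\<in>A - {x}. (q * u x - u j / q) / (u x - u j))"
        using c by (simp add: prod_uminus)
      finally show ?thesis .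
    qed
    have "(\<Sum>xs\<in>permutations_of_set A. pairprod ?\<phi> xs) =
        (\<Sum>x\<in>A. \<Sum>ys\<in>(#) x ` permutations_of_set (A - {x}). pairprod ?\<phi> ys)"
      unfolding permutations_of_set_nonempty[OF False] using psubset(1)
      by (intro sum.UNION_disjoint) auto
    also have "\<dots> = (\<Sum>x\<in>A. (- 1) ^ r * (\<Prod>j\<in>A - {x}. (q * u x - u j / q) / (u x - u j)) * sgn_qfact q r)"
      by (intro sum.cong inner refl)
    also have "\<dots> = (- 1) ^ r * (\<Sum>x\<in>A. \<Prod>j\<in>A - {x}. (q * u x - u j / q) / (u x - u j)) * sgn_qfact q r"
      by (simp add: sum_distrib_left sum_distrib_right)
    also have "(\<Sum>x\<in>A. \<Prod>j\<in>A - {x}. (q * u x - u j / q) / (u x - u j)) =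
        (q ^ card A - 1 / q ^ card A) / (q - 1 / q)"
      using psubset.hyps False psubset.prems q by (intro sum_prod_interpolation) auto
    also have "(- 1) ^ r * ((q ^ card A - 1 / q ^ card A) / (q - 1 / q)) * sgn_qfact q r =
        sgn_qfact q (card A)"
      by (simp add: sgn_qfact_def r)
    finally show ?thesis .
  qed (simp add: sgn_qfact_def)
qed

text \<open>A vanishing quantum integer of index \<open>k\<close> would give
  \<open>q^(2k) = 1\<close>.\<close>

lemma sgn_qfact_nonzero:
  assumes "q \<noteq> 0" "\<And>k. k > 0 \<Longrightarrow> q ^ k \<noteq> 1"
  shows "sgn_qfact q r \<noteq> 0"
proof -
  have "q ^ k - 1 / q ^ k \<noteq> 0" if "k > 0" for k
  proof
    assume "q ^ k - 1 / q ^ k = 0"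
    then have "q ^ (k + k) = 1" using assms(1) by (simp add: field_simps power_add)
    then show False using assms(2)[of "k + k"] that by simp
  qed
  from this this[of 1] show ?thesis by (simp add: sgn_qfact_def)
qed

section \<open>Pointwise comparison of meromorphic functions on a dense open set\<close>

lemma closure_nonvan:
  fixes f :: "complex^'n::finite \<Rightarrow> complex"
  assumes "nonvan_on f UNIV"
  shows "closure {x. f x \<noteq> 0} = UNIV"
proof -
  have "x \<in> closure {x. f x \<noteq> 0}" for x
    unfolding closure_iff_nhds_not_empty
  proof (intro allI impI)
    fix S V assume "V \<subseteq> S" "open V" "x \<in> V"
    then have "\<exists>w\<in>V. f w \<noteq> 0" using assms unfolding nonvan_on_def by blast
    then show "{x. f x \<noteq> 0} \<inter> S \<noteq> {}" using \<open>V \<subseteq> S\<close> by blast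
  qed
  then show ?thesis by blast
qed

text \<open>The set is the complement of the zeros of a single holomorphic function, the product of
  the denominators of all \<open>h\<close> with distinct indices.\<close>

lemma generic_point:
  assumes "l \<noteq> 0"
  shows "\<exists>W :: (complex^'n::finite) set. open W \<and> closure W = UNIV \<and>
           (\<forall>x\<in>W. \<forall>i j. i \<noteq> j \<longrightarrow> qpow l (- 2 * (x $ i - x $ j)) \<noteq> 1)"
proof -
  define F where "F = (\<lambda>S (x::complex^'n). \<Prod>(i, j)\<in>S. qpow l (- 2 * (x $ i - x $ j)) - 1)"
  have F: "holo_on (F S) UNIV \<and> nonvan_on (F S) UNIV" if "S \<subseteq> {(i, j). i \<noteq> j}" for S
    using finite[of S] that
  proof (induction S rule: finite_induct)
    case (insert p S)
    obtain i j where p: "p = (i, j)" "i \<noteq> j" using insert.prems by auto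
    let ?f = "\<lambda>x::complex^'n. qpow l (- 2 * (x $ i - x $ j)) - 1"
    have eq: "F (insert p S) = (\<lambda>x. ?f x * F S x)" using insert.hyps by (simp add: F_def p)
    have holo: "holo_on ?f UNIV"
      using holo_on_add[OF holo_qpow_diff holo_on_const[of "- 1"]] by simp
    have "nonvan_on ?f UNIV" using nonvan_qpow_diff[OF assms p(2)] by simp
    with holo insert show ?case unfolding eq
      by (auto intro!: holo_on_mult nonvan_on_mult holo_onD_cont)
  qed (simp add: F_def)
  define G where "G = F {(i, j). i \<noteq> j}"
  have G: "holo_on G UNIV" "nonvan_on G UNIV" using F[of "{(i, j). i \<noteq> j}"] by (auto simp: G_def)
  have "open (G -` (- {0}) \<inter> UNIV)"
    using holo_onD_cont[OF G(1)] by (intro continuous_on_open_vimage[THEN iffD1, rule_format]) auto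
  then have "open {x. G x \<noteq> 0}" by (simp add: vimage_def Compl_eq)
  moreover have "qpow l (- 2 * (x $ i - x $ j)) \<noteq> 1" if "G x \<noteq> 0" "i \<noteq> j" for x i j
    using that by (auto simp: G_def F_def)
  ultimately show ?thesis using closure_nonvan[OF G(2)] by blast
qed

text \<open>Carrying a representative along sums and products reduces an identity of classes to an
  identity of functions at generic points.\<close>

definition mero_rep :: "(complex^'n::finite \<Rightarrow> complex) \<Rightarrow> 'n mero \<Rightarrow> bool" where
  "mero_rep f F \<longleftrightarrow> merom f \<and> F = abs_mero f"

lemma mero_rep_mult: "mero_rep f F \<Longrightarrow> mero_rep g G \<Longrightarrow> mero_rep (\<lambda>x. f x * g x) (F * G)"
  by (auto simp: mero_rep_def merom_mult times_mero.abs_eq)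

lemma mero_rep_add: "mero_rep f F \<Longrightarrow> mero_rep g G \<Longrightarrow> mero_rep (\<lambda>x. f x + g x) (F + G)"
  by (auto simp: mero_rep_def merom_add plus_mero.abs_eq)

lemma mero_rep_uminus: "mero_rep f F \<Longrightarrow> mero_rep (\<lambda>x. - f x) (- F)"
  by (auto simp: mero_rep_def merom_uminus uminus_mero.abs_eq)

lemma mero_rep_0: "mero_rep (\<lambda>_. 0) 0" and mero_rep_1: "mero_rep (\<lambda>_. 1) 1"
  by (auto simp: mero_rep_def zero_mero_def one_mero_def)

lemma mero_rep_hm: "mero_rep (\<lambda>x. hfun l (x $ i - x $ j)) (hm l i j)"
  by (auto simp: mero_rep_def merom_hfun_diff hm.abs_eq)

lemma mero_rep_sum:
  "(\<And>s. s \<in> A \<Longrightarrow> mero_rep (f s) (F s)) \<Longrightarrow> mero_rep (\<lambda>x. \<Sum>s\<in>A. f s x) (\<Sum>s\<in>A. F s)"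
  by (induction A rule: infinite_finite_induct) (auto simp: mero_rep_0 mero_rep_add)

lemma mero_rep_prod_list:
  "(\<And>s. s \<in> set xs \<Longrightarrow> mero_rep (f s) (F s)) \<Longrightarrow>
     mero_rep (\<lambda>x. prod_list (map (\<lambda>s. f s x) xs)) (prod_list (map F xs))"
  by (induction xs) (auto simp: mero_rep_1 mero_rep_mult)

lemma mero_rep_pairprod:
  "(\<And>i j. mero_rep (f i j) (F i j)) \<Longrightarrow>
     mero_rep (\<lambda>x. pairprod (\<lambda>i j. f i j x) xs) (pairprod F xs)"
  by (induction xs) (auto simp: mero_rep_1 intro!: mero_rep_mult mero_rep_prod_list)

lemma mero_rep_const: "mero_rep (\<lambda>_. c) (mero_const c)"
  by (auto simp: mero_rep_def mero_const.abs_eq)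

lemma mero_rep_eqI:
  assumes "mero_rep f F" "mero_rep g G" "agree f g"
  shows "F = G"
  using assms unfolding mero_rep_def
  by (auto intro!: Quotient_rel_abs[OF Quotient_mero])

text \<open>Multiplying numerator and denominator by \<open>exp (- 2 * l * b)\<close> turns
  \<open>h\<close> into the quotient that occurs in the interpolation formula.\<close>

lemma hfun_fraction:
  assumes "exp l = q" "qpow l (- 2 * (a - b)) \<noteq> 1"
  shows "exp (- 2 * l * a) \<noteq> exp (- 2 * l * b)"
    and "hfun l (a - b) = (q * exp (- 2 * l * a) - exp (- 2 * l * b) / q) /
           (exp (- 2 * l * a) - exp (- 2 * l * b))"
proof -
  let ?u = "exp (- 2 * l * a)" and ?v = "exp (- 2 * l * b)"
  have uv: "qpow l (- 2 * (a - b)) = ?u / ?v"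
    by (simp add: qpow_def exp_diff[symmetric] algebra_simps)
  show ne: "?u \<noteq> ?v" using assms(2) unfolding uv by auto
  have q: "qpow l 1 = q" "qpow l (- 2) = 1 / (q * q)" "q \<noteq> 0"
    unfolding assms(1)[symmetric] by (auto simp: qpow_def exp_add[symmetric] exp_minus field_simps)
  have "?v \<noteq> 0" by simp
  then show "hfun l (a - b) = (q * ?u - ?v / q) / (?u - ?v)"
    unfolding hfun_def uv q(1,2) using ne q(3) by (simp add: divide_simps)
qed

text \<open>At a generic point the nodes \<open>exp (- 2 * l * x $ i)\<close> are distinct and
  nonzero, so the numerical identity applies on a dense open set.\<close>

lemma sum_permutations_hm:
  assumes "exp l = q" and "\<And>k::nat. k > 0 \<Longrightarrow> q ^ k \<noteq> 1"
  shows "(\<Sum>xs\<in>permutations_of_set A. pairprod (\<lambda>i j. - hm l i j) xs :: 'n::finite mero) =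
         mero_const (sgn_qfact q (card A))"
proof (rule mero_rep_eqI)
  have l0: "l \<noteq> 0" using assms(1) assms(2)[of 1] by auto
  obtain W :: "(complex^'n) set" where W: "open W" "closure W = UNIV"
    "\<forall>x\<in>W. \<forall>i j. i \<noteq> j \<longrightarrow> qpow l (- 2 * (x $ i - x $ j)) \<noteq> 1"
    using generic_point[OF l0] by (elim exE conjE)
  then have ne: "qpow l (- 2 * (x $ i - x $ j)) \<noteq> 1" if "x \<in> W" "i \<noteq> j" for x i j
    using that by simp
  show "mero_rep (\<lambda>x. \<Sum>xs\<in>permutations_of_set A. pairprod (\<lambda>i j. - hfun l (x $ i - x $ j)) xs)
      (\<Sum>xs\<in>permutations_of_set A. pairprod (\<lambda>i j. - hm l i j) xs)"
    by (intro mero_rep_sum mero_rep_pairprod mero_rep_uminus mero_rep_hm)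
  show "mero_rep (\<lambda>_. sgn_qfact q (card A)) (mero_const (sgn_qfact q (card A)) :: 'n mero)"
    by (rule mero_rep_const)
  have "(\<Sum>xs\<in>permutations_of_set A. pairprod (\<lambda>i j. - hfun l (x $ i - x $ j)) xs) =
      sgn_qfact q (card A)" if x: "x \<in> W" for x
  proof -
    define u where "u = (\<lambda>i. exp (- 2 * l * x $ i))"
    have "(\<Sum>xs\<in>permutations_of_set A. pairprod (\<lambda>i j. - hfun l (x $ i - x $ j)) xs) =
        (\<Sum>xs\<in>permutations_of_set A. pairprod (\<lambda>i j. - ((q * u i - u j / q) / (u i - u j))) xs)"
      by (intro sum.cong refl pairprod_cong)
        (use hfun_fraction(2)[OF assms(1) ne[OF x]] in
          \<open>auto simp: permutations_of_set_def u_def\<close>)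
    also have "\<dots> = sgn_qfact q (card A)"
      using assms(1) assms(2)[of 2] hfun_fraction(1)[OF assms(1) ne[OF x]]
      by (intro sum_permutations_pairprod) (auto simp: u_def inj_on_def)
    finally show ?thesis .
  qed
  then show "agree (\<lambda>x. \<Sum>xs\<in>permutations_of_set A. pairprod (\<lambda>i j. - hfun l (x $ i - x $ j)) xs)
      (\<lambda>_. sgn_qfact q (card A))"
    using W unfolding agree_def by blast
qed

text \<open>The case of two indices of the preceding sum; the constant is
  \<open>q + 1/q\<close>.\<close>

lemma hm_add_flip:
  assumes "exp l = q" and "\<And>k::nat. k > 0 \<Longrightarrow> q ^ k \<noteq> 1" and "i \<noteq> j"
  shows "hm l i j + hm l j i = mero_const (- sgn_qfact q 2)"
proof -
  have "- hm l i j + - hm l j i = mero_const (sgn_qfact q 2)"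
    using sum_permutations_hm[OF assms(1,2), of "{i, j}"] assms(3)
    by (simp add: permutations_of_set_doubleton numeral_2_eq_2)
  moreover have "mero_const (- c) = - mero_const c" for c
    by transfer simp
  ultimately show ?thesis by (metis add.inverse_inverse minus_add_distrib)
qed


section \<open>The relations of the dynamical quantum matrices\<close>

text \<open>Scaling is left multiplication by a multiple of the unit, whose centrality is checked
  term by term.\<close>

lemma cscale_commute: "cscale c (a * x) = a * cscale c (x :: 'k::monoid_add \<Rightarrow>\<^sub>0 complex)"
proof -
  have "Poly_Mapping.single 0 c * a = a * Poly_Mapping.single 0 c"
  proof (induction a rule: Poly_Mapping.update_induct)
    case const
    then show ?case by simp
  next
    case (update f a b)
    have "Poly_Mapping.update a b f = Poly_Mapping.single a b + f"
      using update by (intro poly_mapping_eqI)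
        (auto simp: lookup_update lookup_add lookup_single not_in_keys_iff_lookup_eq_zero when_def)
    with update show ?case by (simp add: distrib_left distrib_right mult_single mult.commute)
  qed
  then show ?thesis by (simp add: cscale_def mult.assoc[symmetric])
qed

lemma cscale_mult_left: "cscale c x * a = cscale c (x * a)"
  by (simp add: cscale_def mult.assoc)

lemma two_sided_ideal_ideal_gen: "two_sided_ideal (ideal_gen R)"
proof
  let ?S = "{a * r * b |a r b. r \<in> R}"
  show "0 \<in> ideal_gen R" by (simp add: ideal_gen_def cs.span_zero)
  show "x + y \<in> ideal_gen R" if "x \<in> ideal_gen R" "y \<in> ideal_gen R" for x y
    using that by (simp add: ideal_gen_def cs.span_add)
  show "a * x \<in> ideal_gen R" if "x \<in> ideal_gen R" for a x
    using that unfolding ideal_gen_def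
  proof (induction x rule: cs.span_induct_alt)
    case (step c x y)
    then obtain a' r b where "x = a' * r * b" "r \<in> R" by blast
    then have "a * x = (a * a') * r * b" by (simp add: mult.assoc)
    with \<open>r \<in> R\<close> have "a * x \<in> ?S" by blast
    from cs.span_add[OF cs.span_scale[OF cs.span_base[OF this]] step(2)] show ?case by (simp add: distrib_left cscale_commute)
  qed (simp add: cs.span_zero)
  show "x * a \<in> ideal_gen R" if "x \<in> ideal_gen R" for a x
    using that unfolding ideal_gen_def
  proof (induction x rule: cs.span_induct_alt)
    case (step c x y)
    then obtain a' r b where "x = a' * r * b" "r \<in> R" by blast
    then have "x * a = a' * r * (b * a)" by (simp add: mult.assoc)
    with \<open>r \<in> R\<close> have "x * a \<in> ?S" by blast
    from cs.span_add[OF cs.span_scale[OF cs.span_base[OF this]] step(2)] show ?case by (simp add: distrib_right cscale_mult_left)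
  qed (simp add: cs.span_zero)
qed

lemma ideal_gen_base: "r \<in> R \<Longrightarrow> r \<in> ideal_gen R"
  unfolding ideal_gen_def by (rule cs.span_base) (force intro: exI[of _ 1])

lemma mero_shift_hm:
  fixes i j k :: "'n::finite"
  assumes "i \<noteq> j" "i \<noteq> k"
  shows "mero_shift i (hm l j k) = hm l j k"
  using assms
proof transfer
  fix i j k :: 'n and l :: complex assume "i \<noteq> j" "i \<noteq> k"
  then have "(\<lambda>x::complex^'n. hfun l ((x + axis i 1) $ j - (x + axis i 1) $ k)) =
      (\<lambda>x. hfun l (x $ j - x $ k))" by (auto simp: axis_def)
  then show "merom (\<lambda>x::complex^'n. hfun l ((x + axis i 1) $ j - (x + axis i 1) $ k)) \<and>
      merom (\<lambda>x::complex^'n. hfun l (x $ j - x $ k)) \<and>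
      agree (\<lambda>x::complex^'n. hfun l ((x + axis i 1) $ j - (x + axis i 1) $ k))
        (\<lambda>x. hfun l (x $ j - x $ k))"
    by (simp add: merom_hfun_diff)
qed

lemma mero_const_1: "mero_const 1 = 1"
  by transfer simp

text \<open>The parameter \<open>ty\<close> fixes the index type, and \<open>not_root\<close>
  expresses that \<open>q\<close> is generic.\<close>

locale generic_q =
  fixes q l :: complex and ty :: "'n::{finite,linorder} itself"
  assumes exp_l: "exp l = q" and not_root: "k > 0 \<Longrightarrow> q ^ k \<noteq> 1"
begin

abbreviation FR :: "'n fr_gen free_alg set" where "FR \<equiv> FR_ideal l"

sublocale two_sided_ideal FR
  unfolding FR_ideal_def by (rule two_sided_ideal_ideal_gen)

notation cong (infix \<open>\<doteq>\<close> 50)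

section \<open>The defining relations as congruences\<close>

lemma cong_rel: "x - y \<in> FR_rels l \<Longrightarrow> x \<doteq> y"
  by (unfold cong_def, unfold FR_ideal_def, rule ideal_gen_base)

lemma mu_rel:
  assumes "x - y \<in> mero_rels mu_l \<union> mero_rels mu_r"
  shows "x \<doteq> y"
  by (rule cong_rel, unfold FR_rels_def) (use assms in blast)

lemma mu_l_const: "mu_l (mero_const c) \<doteq> cscale c 1"
  by (rule mu_rel, unfold mero_rels_def) blast

lemma mu_r_const: "mu_r (mero_const c) \<doteq> cscale c 1"
  by (rule mu_rel, unfold mero_rels_def) blast

sublocale mul: ideal_hom FR mu_l
proof
  fix f g :: "'n mero"
  show "mu_l (f + g) \<doteq> mu_l f + mu_l g" by (rule mu_rel, unfold mero_rels_def) blast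
  show "mu_l (f * g) \<doteq> mu_l f * mu_l g" by (rule mu_rel, unfold mero_rels_def) blast
  show "mu_l 1 \<doteq> 1" using mu_l_const[of 1] by (simp add: mero_const_1)
qed

sublocale mur: ideal_hom FR mu_r
proof
  fix f g :: "'n mero"
  show "mu_r (f + g) \<doteq> mu_r f + mu_r g" by (rule mu_rel, unfold mero_rels_def) blast
  show "mu_r (f * g) \<doteq> mu_r f * mu_r g" by (rule mu_rel, unfold mero_rels_def) blast
  show "mu_r 1 \<doteq> 1" using mu_r_const[of 1] by (simp add: mero_const_1)
qed

lemma mu_commute: "mu_l f * mu_r g \<doteq> mu_r g * mu_l f"
  by (rule cong_rel, unfold FR_rels_def, ((rule UnI2, blast) | rule UnI1)+)

lemma mu_l_t: "mu_l f * t_el i j \<doteq> t_el i j * mu_l (mero_shift i f)"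
  by (rule cong_rel, unfold FR_rels_def, ((rule UnI2, blast) | rule UnI1)+)

lemma mu_r_t: "mu_r f * t_el i j \<doteq> t_el i j * mu_r (mero_shift j f)"
  by (rule cong_rel, unfold FR_rels_def, ((rule UnI2, blast) | rule UnI1)+)

lemma t_same_row:
  assumes "k < m"
  shows "mu_r (hm l k m) * t_el i k * t_el i m \<doteq> t_el i m * t_el i k"
  by (rule cong_rel, unfold FR_rels_def) (use assms in blast)

lemma t_same_column:
  assumes "i < j"
  shows "mu_l (hm l j i) * t_el j k * t_el i k \<doteq> t_el i k * t_el j k"
  by (rule cong_rel, unfold FR_rels_def) (use assms in blast)

lemma t_exchange:
  assumes "i < j" "k < m"
  shows "t_el i k * t_el j m \<doteq>
    t_el j m * t_el i k + (mu_l (hm l j i) - mu_r (hm l k m)) * t_el j k * t_el i m"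
  by (rule cong_rel, unfold FR_rels_def) (use assms in blast)

lemma t_minor_swap:
  assumes "i < j" "k < m"
  shows "t_el i m * t_el j k - mu_l (hm l j i) * t_el j m * t_el i k \<doteq>
    mu_r (- hm l m k) * (t_el i k * t_el j m - mu_l (hm l j i) * t_el j k * t_el i m)"
  by (rule cong_rel, unfold FR_rels_def) (use assms in blast)

text \<open>Both sums are the constant \<open>q + 1/q\<close>, and \<open>mu_l\<close> and
  \<open>mu_r\<close> agree on constants.\<close>

lemma hm_sum_central:
  assumes "i \<noteq> j" "k \<noteq> m"
  shows "mu_r (hm l i j) + mu_r (hm l j i) \<doteq> mu_l (hm l k m) + mu_l (hm l m k)"
proof -
  define c where "c = - sgn_qfact q 2"
  have "mu_r (hm l i j) + mu_r (hm l j i) \<doteq> mu_r (hm l i j + hm l j i)"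
    by (rule cong_sym[OF mur.hom_add])
  also have "\<dots> = mu_r (mero_const c)" using hm_add_flip[OF exp_l not_root assms(1)] by (simp add: c_def)
  also have "\<dots> \<doteq> cscale c 1" by (rule mu_r_const)
  also have "\<dots> \<doteq> mu_l (mero_const c)" by (rule cong_sym[OF mu_l_const])
  also have "\<dots> = mu_l (hm l k m + hm l m k)"
    using hm_add_flip[OF exp_l not_root assms(2)] by (simp add: c_def)
  also have "\<dots> \<doteq> mu_l (hm l k m) + mu_l (hm l m k)" by (rule mul.hom_add)
  finally show ?thesis .
qed

lemma quad_l_eq: "quad mu_l h t x1 x2 y1 y2 \<doteq> t x1 y1 * t x2 y2 - mu_l (h x2 x1) * (t x2 y1 * t x1 y2)"
  and quad_r_eq: "quad mu_r h t x1 x2 y1 y2 \<doteq> t x1 y1 * t x2 y2 - mu_r (h x2 x1) * (t x2 y1 * t x1 y2)"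
proof -
  have "mu_l (- h x2 x1) * (t x2 y1 * t x1 y2) \<doteq> - mu_l (h x2 x1) * (t x2 y1 * t x1 y2)"
    by (intro cong_mult_right mul.hom_uminus)
  from cong_add[OF cong_refl this]
  show "quad mu_l h t x1 x2 y1 y2 \<doteq> t x1 y1 * t x2 y2 - mu_l (h x2 x1) * (t x2 y1 * t x1 y2)"
    by (simp add: quad_def)
  have "mu_r (- h x2 x1) * (t x2 y1 * t x1 y2) \<doteq> - mu_r (h x2 x1) * (t x2 y1 * t x1 y2)"
    by (intro cong_mult_right mur.hom_uminus)
  from cong_add[OF cong_refl this]
  show "quad mu_r h t x1 x2 y1 y2 \<doteq> t x1 y1 * t x2 y2 - mu_r (h x2 x1) * (t x2 y1 * t x1 y2)"
    by (simp add: quad_def)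
qed

text \<open>The column counterpart of \<open>t_minor_swap\<close>. The two products on the left are
  expressed through one minor \<open>\<xi>\<close>, and \<open>h x + h (- x)\<close> is transferred
  from \<open>mu_r\<close> to \<open>mu_l\<close>.\<close>

lemma quad_column_swap:
  assumes "c < d" "x < y"
  shows "t_el x d * t_el y c - mu_r (hm l c d) * (t_el x c * t_el y d) \<doteq>
    mu_l (- hm l x y) * (t_el y d * t_el x c - mu_r (hm l c d) * (t_el y c * t_el x d))"
proof -
  let ?L = "mu_l (hm l y x)" and ?L' = "mu_l (hm l x y)"
  let ?H = "mu_r (hm l c d)" and ?H' = "mu_r (hm l d c)"
  let ?A = "t_el x c * t_el y d" and ?B = "t_el y d * t_el x c"
  let ?C = "t_el x d * t_el y c" and ?D = "t_el y c * t_el x d"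
  \<comment> \<open>The minor on the rows \<open>x, y\<close> and columns \<open>c, d\<close> in its
    column-antisymmetrised form.\<close>
  define \<xi> where "\<xi> = ?B - ?H * ?D"
  have A: "?A \<doteq> \<xi> + ?L * ?D"
    using t_exchange[OF assms(2,1)] by (simp add: \<xi>_def algebra_simps)
  have "?C - ?L * ?B \<doteq> mu_r (- hm l d c) * (?A - ?L * ?D)"
    using t_minor_swap[OF assms(2,1)] by (simp add: mult.assoc)
  also have "\<dots> \<doteq> - ?H' * (\<xi> + ?L * ?D - ?L * ?D)"
    by (intro cong_mult mur.hom_uminus cong_diff A cong_refl)
  finally have "?C - ?L * ?B \<doteq> - ?H' * \<xi>" by simp
  then have "?C - ?L * ?B + ?L * ?B \<doteq> - ?H' * \<xi> + ?L * ?B" by (intro cong_add cong_refl)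
  then have C: "?C \<doteq> ?L * ?B - ?H' * \<xi>" by simp
  have "?C - ?H * ?A \<doteq> ?L * ?B - ?H' * \<xi> - ?H * (\<xi> + ?L * ?D)"
    by (intro cong_diff C cong_mult_left A)
  also have "\<dots> = ?L * ?B - (?H + ?H') * \<xi> - ?H * ?L * ?D" by (simp add: algebra_simps)
  \<comment> \<open>With \<open>?H + ?H'\<close> replaced by \<open>?L + ?L'\<close>, the terms
    containing \<open>?L\<close> cancel by the definition of \<open>\<xi>\<close>.\<close>
  also have "\<dots> \<doteq> ?L * ?B - (?L + ?L') * \<xi> - ?L * ?H * ?D"
    using assms by (intro cong_diff cong_mult_right cong_refl hm_sum_central cong_sym[OF mu_commute]) auto
  also have "\<dots> = - ?L' * \<xi>" by (simp add: \<xi>_def algebra_simps)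
  also have "\<dots> \<doteq> mu_l (- hm l x y) * \<xi>"
    by (intro cong_mult_right cong_sym[OF mul.hom_uminus])
  finally show ?thesis by (simp add: \<xi>_def)
qed

text \<open>Rows are antisymmetrised with functions of \<open>\<lambda>\<close>; inversions are
  descents, so the sorted list of columns is the increasing one.\<close>

sublocale rows: dyn_antisym FR mu_l mu_r t_el "hm l" "\<lambda>x y. y < x"
proof
  fix x1 x2 y1 y2 y :: 'n
  assume x: "x1 < x2"
  show "quad mu_l (hm l) t_el x1 x2 y2 y1 \<doteq> mu_r (- hm l y2 y1) * quad mu_l (hm l) t_el x1 x2 y1 y2"
    if "y1 < y2"
  proof -
    have "quad mu_l (hm l) t_el x1 x2 y2 y1 \<doteq>
        t_el x1 y2 * t_el x2 y1 - mu_l (hm l x2 x1) * (t_el x2 y2 * t_el x1 y1)" by (rule quad_l_eq)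
    also have "t_el x1 y2 * t_el x2 y1 - mu_l (hm l x2 x1) * (t_el x2 y2 * t_el x1 y1) \<doteq>
        mu_r (- hm l y2 y1) * (t_el x1 y1 * t_el x2 y2 - mu_l (hm l x2 x1) * (t_el x2 y1 * t_el x1 y2))"
      using t_minor_swap[OF x that] by (simp add: mult.assoc)
    also have "\<dots> \<doteq> mu_r (- hm l y2 y1) * quad mu_l (hm l) t_el x1 x2 y1 y2"
      by (intro cong_mult_left cong_sym[OF quad_l_eq])
    finally show ?thesis .
  qed
  have "quad mu_l (hm l) t_el x1 x2 y y \<doteq>
      t_el x1 y * t_el x2 y - mu_l (hm l x2 x1) * (t_el x2 y * t_el x1 y)" by (rule quad_l_eq)
  also have "t_el x1 y * t_el x2 y - mu_l (hm l x2 x1) * (t_el x2 y * t_el x1 y) \<doteq>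
      t_el x1 y * t_el x2 y - t_el x1 y * t_el x2 y"
    using t_same_column[OF x, of y] by (intro cong_diff cong_refl) (simp add: mult.assoc)
  finally show "quad mu_l (hm l) t_el x1 x2 y y \<doteq> 0" by simp
qed (use mu_commute mu_l_t mu_r_t mero_shift_hm in auto)

text \<open>Here rows and columns, and \<open>\<lambda>\<close> and \<open>\<mu>\<close>, change
  places. Inversions are ascents, so the sorted list of rows is the decreasing one.\<close>

sublocale cols: dyn_antisym FR mu_r mu_l "\<lambda>x y. t_el y x" "hm l" "(<)"
proof
  fix x1 x2 y1 y2 y :: 'n
  assume x: "x2 < x1"
  show "quad mu_r (hm l) (\<lambda>x y. t_el y x) x1 x2 y2 y1 \<doteq>
      mu_l (- hm l y2 y1) * quad mu_r (hm l) (\<lambda>x y. t_el y x) x1 x2 y1 y2"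
    if "y2 < y1"
  proof -
    have "quad mu_r (hm l) (\<lambda>x y. t_el y x) x1 x2 y2 y1 \<doteq>
        t_el y2 x1 * t_el y1 x2 - mu_r (hm l x2 x1) * (t_el y2 x2 * t_el y1 x1)" by (rule quad_r_eq)
    also have "t_el y2 x1 * t_el y1 x2 - mu_r (hm l x2 x1) * (t_el y2 x2 * t_el y1 x1) \<doteq>
        mu_l (- hm l y2 y1) * (t_el y1 x1 * t_el y2 x2 - mu_r (hm l x2 x1) * (t_el y1 x2 * t_el y2 x1))"
      by (rule quad_column_swap[OF x that])
    also have "\<dots> \<doteq> mu_l (- hm l y2 y1) * quad mu_r (hm l) (\<lambda>x y. t_el y x) x1 x2 y1 y2"
      by (intro cong_mult_left cong_sym[OF quad_r_eq])
    finally show ?thesis .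
  qed
  have "quad mu_r (hm l) (\<lambda>x y. t_el y x) x1 x2 y y \<doteq>
      t_el y x1 * t_el y x2 - mu_r (hm l x2 x1) * (t_el y x2 * t_el y x1)" by (rule quad_r_eq)
  also have "t_el y x1 * t_el y x2 - mu_r (hm l x2 x1) * (t_el y x2 * t_el y x1) \<doteq>
      t_el y x1 * t_el y x2 - t_el y x1 * t_el y x2"
    using t_same_row[OF x, of y] by (intro cong_diff cong_refl) (simp add: mult.assoc)
  finally show "quad mu_r (hm l) (\<lambda>x y. t_el y x) x1 x2 y y \<doteq> 0" by simp
qed (use cong_sym[OF mu_commute] mu_l_t mu_r_t mero_shift_hm in auto)

end


section \<open>Quantum minors as sums over lists\<close>

lemma nth_el_less_iff:
  assumes "i \<in> {1..card I}" "j \<in> {1..card I}"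
  shows "nth_el I i < nth_el I j \<longleftrightarrow> i < j"
proof -
  have mono: "nth_el I a < nth_el I b" if "a < b" "1 \<le> a" "b \<le> card I" for a b
    using that sorted_wrt_nth_less[OF strict_sorted_list_of_set[of I], of "a - 1" "b - 1"]
    by (simp add: nth_el_def)
  show ?thesis using mono[of i j] mono[of j i] assms by (cases i j rule: linorder_cases) auto
qed

lemma map_nth_el: "map (nth_el I) [1..<Suc (card I)] = sorted_list_of_set I"
  by (rule nth_equalityI) (simp_all add: nth_el_def nth_append del: upt_Suc)

lemma nth_el_in: "k \<in> {1..card I} \<Longrightarrow> nth_el I k \<in> I"
  using nth_mem[of "k - 1" "sorted_list_of_set I"] by (simp add: nth_el_def) linarith

definition perm_list :: "'n::{finite,linorder} set \<Rightarrow> (nat \<Rightarrow> nat) \<Rightarrow> 'n list" where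
  "perm_list I \<sigma> = map (\<lambda>k. nth_el I (\<sigma> k)) [1..<Suc (card I)]"

text \<open>Surjectivity follows from injectivity by counting.\<close>

lemma bij_betw_perm_list:
  "bij_betw (perm_list I) {\<sigma>. \<sigma> permutes {1..card I}} (permutations_of_set I)"
proof -
  let ?S = "{\<sigma>. \<sigma> permutes {1..card I}}"
  have inj_nth: "inj_on (nth_el I) {1..card I}"
  proof (rule linorder_inj_onI')
    fix i j assume "i \<in> {1..card I}" "j \<in> {1..card I}" "i < j"
    then have "nth_el I i < nth_el I j" using nth_el_less_iff by blast
    then show "nth_el I i \<noteq> nth_el I j" by simp
  qed
  have inj: "inj_on (perm_list I) ?S"
  proof (rule inj_onI)
    fix \<sigma> \<tau> assume st: "\<sigma> \<in> ?S" "\<tau> \<in> ?S" "perm_list I \<sigma> = perm_list I \<tau>"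
    show "\<sigma> = \<tau>"
    proof
      fix k
      show "\<sigma> k = \<tau> k"
      proof (cases "k \<in> {1..card I}")
        case True
        then have "nth_el I (\<sigma> k) = nth_el I (\<tau> k)"
          using st(3) by (simp add: perm_list_def del: upt_Suc)
        moreover have "\<sigma> k \<in> {1..card I}" "\<tau> k \<in> {1..card I}"
          using st(1,2) True permutes_in_image[of \<sigma> "{1..card I}" k]
            permutes_in_image[of \<tau> "{1..card I}" k] by simp_all
        ultimately show ?thesis using inj_nth by (meson inj_onD)
      next
        case False
        then show ?thesis using st(1,2) permutes_not_in[of \<sigma>] permutes_not_in[of \<tau>] by simp
      qed
    qed
  qed
  have "perm_list I \<sigma> \<in> permutations_of_set I" if s: "\<sigma> permutes {1..card I}" for \<sigma>
  proof
    have im: "\<sigma> ` {1..card I} = {1..card I}" using permutes_image[OF s] .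
    have "inj_on (\<lambda>k. nth_el I (\<sigma> k)) {1..card I}"
      using comp_inj_on[OF permutes_inj_on[OF s, of "{1..card I}"], of "nth_el I"] inj_nth
      unfolding im by (simp add: o_def)
    then show d: "distinct (perm_list I \<sigma>)"
      by (simp add: perm_list_def distinct_map atLeastLessThanSuc_atLeastAtMost del: upt_Suc)
    have "nth_el I (\<sigma> k) \<in> I" if "k \<in> {1..card I}" for k
      using that im by (intro nth_el_in) blast
    then have "set (perm_list I \<sigma>) \<subseteq> I"
      by (auto simp: perm_list_def atLeastLessThanSuc_atLeastAtMost simp del: upt_Suc)
    moreover have "card (set (perm_list I \<sigma>)) = card I"
      using distinct_card[OF d] by (simp add: perm_list_def del: upt_Suc)
    ultimately show "set (perm_list I \<sigma>) = I" by (simp add: card_subset_eq)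
  qed
  then have "perm_list I ` ?S \<subseteq> permutations_of_set I" by blast
  moreover have "card (perm_list I ` ?S) = card (permutations_of_set I)"
    using card_image[OF inj] card_permutations[of "{1..card I}" "card I"] by simp
  ultimately have "perm_list I ` ?S = permutations_of_set I" by (simp add: card_subset_eq)
  with inj show ?thesis by (simp add: bij_betw_def)
qed

text \<open>Since \<open>nth_el I\<close> is strictly increasing, inversions of
  \<open>\<sigma>\<close> are descents of the list; all other pairs contribute 1.\<close>

lemma prod_invs:
  assumes "\<sigma> permutes {1..card I}"
  shows "(\<Prod>(k, m)\<in>invs (card I) \<sigma>. g (nth_el I (\<sigma> k)) (nth_el I (\<sigma> m))) =
    pairprod (\<lambda>x y. if y < x then g x y else 1) (perm_list I \<sigma>)"
  unfolding perm_list_def pairprod_map_upt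
proof (rule prod.mono_neutral_cong_left)
  show "finite {(i, j). 1 \<le> i \<and> i < j \<and> j < Suc (card I)}"
    by (rule finite_subset[of _ "{..card I} \<times> {..card I}"]) auto
  show "invs (card I) \<sigma> \<subseteq> {(i, j). 1 \<le> i \<and> i < j \<and> j < Suc (card I)}"
    by (auto simp: invs_def)
  have iff: "nth_el I (\<sigma> a) < nth_el I (\<sigma> b) \<longleftrightarrow> \<sigma> a < \<sigma> b"
    if "a \<in> {1..card I}" "b \<in> {1..card I}" for a b
    by (rule nth_el_less_iff) (use permutes_in_image[OF assms] that in blast)+
  show "\<forall>p\<in>{(i, j). 1 \<le> i \<and> i < j \<and> j < Suc (card I)} - invs (card I) \<sigma>.
      (case p of (i, j) \<Rightarrow> if nth_el I (\<sigma> j) < nth_el I (\<sigma> i)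
         then g (nth_el I (\<sigma> i)) (nth_el I (\<sigma> j)) else 1) = 1"
    by (auto simp: invs_def iff split: if_splits)
  show "(case p of (k, m) \<Rightarrow> g (nth_el I (\<sigma> k)) (nth_el I (\<sigma> m))) =
      (case p of (i, j) \<Rightarrow> if nth_el I (\<sigma> j) < nth_el I (\<sigma> i)
         then g (nth_el I (\<sigma> i)) (nth_el I (\<sigma> j)) else 1)" if "p \<in> invs (card I) \<sigma>" for p
    using that by (auto simp: invs_def iff)
qed

lemma dyn_S_eq:
  "\<sigma> permutes {1..card I} \<Longrightarrow>
     dyn_S l \<sigma> I = pairprod (wt (\<lambda>x y. y < x) (hm l)) (perm_list I \<sigma>)"
  unfolding dyn_S_def
  by (subst prod_invs[of \<sigma> I "\<lambda>x y. - hm l x y"]) (simp_all add: wt_def[abs_def])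

text \<open>Reversing the list turns descents into ascents and exchanges the arguments of
  \<open>h\<close>, which is the difference between the two signs.\<close>

lemma dyn_S_tilde_eq:
  "\<sigma> permutes {1..card I} \<Longrightarrow>
     dyn_S_tilde l \<sigma> I = pairprod (wt (<) (hm l)) (rev (perm_list I \<sigma>))"
  unfolding dyn_S_tilde_def pairprod_rev
  by (subst prod_invs[of \<sigma> I "\<lambda>x y. - hm l y x"]) (simp_all add: wt_def[abs_def])

lemma minor_eq:
  assumes "card J = card I"
  shows "minor l I J = (\<Sum>xs\<in>permutations_of_set I.
     mu_l (pairprod (wt (\<lambda>x y. y < x) (hm l)) xs) * mon t_el xs (sorted_list_of_set J))"
proof -
  have "mon t_el (perm_list I \<sigma>) (sorted_list_of_set J) =
      prod_list (map (\<lambda>k. t_el (nth_el I (\<sigma> k)) (nth_el J k)) [1..<Suc (card I)])" for \<sigma>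
    unfolding map_nth_el[symmetric] assms perm_list_def mon_def by (simp only: map2_map_map)
  then have "minor l I J = (\<Sum>\<sigma>\<in>{\<sigma>. \<sigma> permutes {1..card I}}.
      mu_l (pairprod (wt (\<lambda>x y. y < x) (hm l)) (perm_list I \<sigma>)) *
        mon t_el (perm_list I \<sigma>) (sorted_list_of_set J))"
    unfolding minor_def by (intro sum.cong) (auto simp: dyn_S_eq)
  also have "\<dots> = (\<Sum>xs\<in>permutations_of_set I.
      mu_l (pairprod (wt (\<lambda>x y. y < x) (hm l)) xs) * mon t_el xs (sorted_list_of_set J))"
    by (rule sum.reindex_bij_betw[OF bij_betw_perm_list])
  finally show ?thesis .
qed


section \<open>Row and column expansions of the determinant\<close>

context generic_q
begin

text \<open>The exchange relation replaces \<open>t_el k i * t_el m j\<close> by the opposite order;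
  the coefficients in \<open>\<lambda>\<close> cancel and only one in \<open>\<mu>\<close>
  remains.\<close>

lemma minor_column_expansion:
  fixes k m i j :: 'n
  assumes "k < m" "i < j"
  shows "minor l {k, m} {i, j} \<doteq> quad mu_r (hm l) (\<lambda>x y. t_el y x) j i m k"
proof -
  have "minor l {k, m} {i, j} =
      mu_l 1 * (t_el k i * t_el m j) + mu_l (- hm l m k) * (t_el m i * t_el k j)"
    using assms by (auto simp: minor_eq permutations_of_set_doubleton wt_def insert_commute)
  also have "\<dots> \<doteq> 1 * (t_el k i * t_el m j) + - mu_l (hm l m k) * (t_el m i * t_el k j)"
    by (intro cong_add cong_mult_right mul.hom_one mul.hom_uminus)
  also have "\<dots> \<doteq> 1 * (t_el m j * t_el k i + (mu_l (hm l m k) - mu_r (hm l i j)) * t_el m i * t_el k j) +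
      - mu_l (hm l m k) * (t_el m i * t_el k j)"
    by (intro cong_add cong_mult_left cong_refl t_exchange assms)
  also have "\<dots> = t_el m j * t_el k i - mu_r (hm l i j) * (t_el m i * t_el k j)"
    by (simp add: algebra_simps)
  also have "\<dots> \<doteq> quad mu_r (hm l) (\<lambda>x y. t_el y x) j i m k"
    by (rule cong_sym[OF quad_r_eq])
  finally show ?thesis .
qed

abbreviation inc_list :: "'n list" where "inc_list \<equiv> sorted_list_of_set UNIV"

lemma det_T_eq: "det_T l = rows.Phi inc_list"
  by (simp add: det_T_def minor_eq rows.Phi_def)

lemma rows_Phi_reorder:
  assumes "ys \<in> rows.perms"
  shows "rows.Phi ys \<doteq> mu_r (pairprod (wt (\<lambda>x y. y < x) (hm l)) ys) * rows.Phi inc_list"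
proof -
  have "rows.Phi ys \<doteq>
      (if distinct ys then mu_r (pairprod (wt (\<lambda>x y. y < x) (hm l)) ys) * rows.Phi inc_list else 0)"
  proof (rule rows.Phi_reorder)
    show "length ys = CARD('n)" using assms by (rule length_finite_permutations_of_set)
    fix zs :: "'n list"
    assume "sorted_wrt (\<lambda>a b. \<not> b < a) zs" "distinct zs" "set zs = UNIV"
    then show "zs = inc_list" by (intro sorted_distinct_set_unique) (auto simp: not_less)
  qed
  then show ?thesis using permutations_of_setD(2)[OF assms] by (simp only: if_True)
qed

lemma cols_Phi_reorder:
  assumes "length ys = CARD('n)"
  shows "cols.Phi ys \<doteq>
    (if distinct ys then mu_l (pairprod (wt (<) (hm l)) ys) * cols.Phi (rev inc_list) else 0)"
proof (rule cols.Phi_reorder[OF assms])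
  fix zs :: "'n list"
  assume "sorted_wrt (\<lambda>a b. \<not> a < b) zs" "distinct zs" "set zs = UNIV"
  then have "rev zs = inc_list" by (intro sorted_distinct_set_unique) (auto simp: not_less sorted_wrt_rev)
  then show "zs = rev inc_list" by (simp add: rev_swap)
qed

text \<open>For each pair of distinct entries exactly one of the two weights differs from the
  default 1.\<close>

lemma pairprod_both:
  "distinct xs \<Longrightarrow> pairprod (wt (<) (hm l)) xs * pairprod (wt (\<lambda>x y. y < x) (hm l)) xs =
     pairprod (\<lambda>i j. - hm l i j) (xs :: 'n list)"
  unfolding pairprod_mult[symmetric] by (rule pairprod_cong) (auto simp: wt_def)

text \<open>
  The sum of \<open>\<mu>\<^sub>l(S) \<mu>\<^sub>r(S') t\<^sub>x\<^sub>1\<^sub>y\<^sub>1 \<dots> t\<^sub>x\<^sub>N\<^sub>y\<^sub>N\<close> over all orderings \<open>x\<close> of the rows and \<open>y\<close> of the columns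
  is the same invertible constant times the row expansion and times the column expansion.
\<close>

lemma det_T_column_expansion: "cols.Phi (rev inc_list) \<doteq> det_T l"
proof -
  let ?w = "pairprod (wt (<) (hm l))" and ?w' = "pairprod (wt (\<lambda>x y. y < x) (hm l))"
  define c where "c = sgn_qfact q CARD('n)"
  have q0: "q \<noteq> 0" using exp_l by auto
  have c0: "c \<noteq> 0" unfolding c_def using sgn_qfact_nonzero[OF q0 not_root] by simp
  have c: "(\<Sum>xs\<in>rows.perms. ?w xs * ?w' xs) = mero_const c"
  proof -
    have "(\<Sum>xs\<in>rows.perms. ?w xs * ?w' xs) = (\<Sum>xs\<in>rows.perms. pairprod (\<lambda>i j. - hm l i j) xs)"
      by (intro sum.cong refl pairprod_both) (auto dest: permutations_of_setD)
    also have "\<dots> = mero_const c" unfolding c_def by (rule sum_permutations_hm[OF exp_l not_root])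
    finally show ?thesis .
  qed
  define Z where "Z = (\<Sum>ys\<in>rows.perms. \<Sum>xs\<in>rows.perms. mu_r (?w ys) * (mu_l (?w' xs) * mon t_el xs ys))"
  \<comment> \<open>Summing over the rows first gives row expansions, which are reordered to
    increasing columns.\<close>
  have "Z = (\<Sum>ys\<in>rows.perms. mu_r (?w ys) * rows.Phi ys)"
    by (simp add: Z_def rows.Phi_def sum_distrib_left)
  also have "\<dots> \<doteq> (\<Sum>ys\<in>rows.perms. mu_r (?w ys) * (mu_r (?w' ys) * rows.Phi inc_list))"
    by (intro cong_sum cong_mult_left rows_Phi_reorder)
  also have "\<dots> = (\<Sum>ys\<in>rows.perms. mu_r (?w ys) * mu_r (?w' ys)) * rows.Phi inc_list"
    by (simp add: sum_distrib_right mult.assoc)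
  also have "\<dots> \<doteq> (\<Sum>ys\<in>rows.perms. mu_r (?w ys * ?w' ys)) * rows.Phi inc_list"
    by (intro cong_sum cong_mult_right cong_sym[OF mur.hom_mult])
  also have "\<dots> \<doteq> mu_r (mero_const c) * rows.Phi inc_list"
    unfolding c[symmetric] by (intro cong_mult_right cong_sym[OF mur.hom_sum])
  also have "\<dots> \<doteq> cscale c 1 * rows.Phi inc_list" by (intro cong_mult_right mu_r_const)
  finally have Z1: "Z \<doteq> cscale c 1 * rows.Phi inc_list" .
  \<comment> \<open>Summing over the columns first gives column expansions, which are reordered to
    decreasing rows.\<close>
  have "Z = (\<Sum>xs\<in>rows.perms. \<Sum>ys\<in>rows.perms. mu_r (?w ys) * mu_l (?w' xs) * mon t_el xs ys)"
    unfolding Z_def by (subst sum.swap) (simp add: mult.assoc)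
  also have "\<dots> \<doteq> (\<Sum>xs\<in>rows.perms. \<Sum>ys\<in>rows.perms. mu_l (?w' xs) * mu_r (?w ys) * mon t_el xs ys)"
    by (intro cong_sum cong_mult_right cong_sym[OF mu_commute])
  also have "\<dots> = (\<Sum>xs\<in>rows.perms. mu_l (?w' xs) * cols.Phi xs)"
    unfolding cols.Phi_def sum_distrib_left
    by (intro sum.cong refl) (simp add: mult.assoc mon_flip[where t = t_el] length_finite_permutations_of_set)
  also have "\<dots> \<doteq> (\<Sum>xs\<in>rows.perms. mu_l (?w' xs) * (mu_l (?w xs) * cols.Phi (rev inc_list)))"
  proof (intro cong_sum cong_mult_left)
    fix xs :: "'n list" assume "xs \<in> rows.perms"
    then show "cols.Phi xs \<doteq> mu_l (?w xs) * cols.Phi (rev inc_list)"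
      using cols_Phi_reorder[of xs] permutations_of_setD[of xs UNIV]
        length_finite_permutations_of_set[of xs UNIV] by simp
  qed
  also have "\<dots> = (\<Sum>xs\<in>rows.perms. mu_l (?w' xs) * mu_l (?w xs)) * cols.Phi (rev inc_list)"
    by (simp add: sum_distrib_right mult.assoc)
  also have "\<dots> \<doteq> (\<Sum>xs\<in>rows.perms. mu_l (?w' xs * ?w xs)) * cols.Phi (rev inc_list)"
    by (intro cong_sum cong_mult_right cong_sym[OF mul.hom_mult])
  also have "\<dots> = (\<Sum>xs\<in>rows.perms. mu_l (?w xs * ?w' xs)) * cols.Phi (rev inc_list)"
    by (simp add: mult.commute)
  also have "\<dots> \<doteq> mu_l (mero_const c) * cols.Phi (rev inc_list)"
    unfolding c[symmetric] by (intro cong_mult_right cong_sym[OF mul.hom_sum])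
  also have "\<dots> \<doteq> cscale c 1 * cols.Phi (rev inc_list)" by (intro cong_mult_right mu_l_const)
  finally have "cscale c 1 * cols.Phi (rev inc_list) \<doteq> cscale c 1 * rows.Phi inc_list"
    using Z1 cong_sym cong_trans by blast
  \<comment> \<open>The scalar \<open>c\<close> is nonzero, so it cancels modulo the ideal.\<close>
  then have "cscale (1 / c) 1 * (cscale c 1 * cols.Phi (rev inc_list)) \<doteq>
      cscale (1 / c) 1 * (cscale c 1 * rows.Phi inc_list)" by (rule cong_mult_left)
  moreover have "cscale (1 / c) 1 * (cscale c 1 * x) = x" for x :: "'n fr_gen free_alg"
    using c0 by (simp add: cscale_mult_left)
  ultimately show ?thesis by (simp add: det_T_eq)
qed

lemma cols_Phi:
  assumes "length ys = CARD('n)"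
  shows "cols.Phi ys \<doteq> (if distinct ys then mu_l (pairprod (wt (<) (hm l)) ys) * det_T l else 0)"
proof -
  note cols_Phi_reorder[OF assms]
  also have "(if distinct ys then mu_l (pairprod (wt (<) (hm l)) ys) * cols.Phi (rev inc_list) else 0) \<doteq>
      (if distinct ys then mu_l (pairprod (wt (<) (hm l)) ys) * det_T l else 0)"
    by (auto intro: cong_mult_left det_T_column_expansion)
  finally show ?thesis .
qed

end


section \<open>Pfaffians as sums over lists of pairs\<close>

text \<open>The second entry of a pair comes first, so that the pairs of a Pfaffian term, taken with
  decreasing \<open>k\<close>, spell out \<open>\<sigma>(2n), ..., \<sigma>(1)\<close>.\<close>

fun flat :: "('b \<times> 'b) list \<Rightarrow> 'b list" where
  "flat [] = []"
| "flat ((a, b) # ps) = b # a # flat ps"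

lemma length_flat [simp]: "length (flat ps) = 2 * length ps"
  by (induction ps rule: flat.induct) auto

lemma flat_inject: "flat ps = flat qs \<Longrightarrow> ps = qs"
proof (induction ps arbitrary: qs rule: flat.induct)
  case 1
  then show ?case by (cases qs rule: flat.cases) auto
next
  case (2 a b ps)
  then show ?case by (cases qs rule: flat.cases) auto
qed

lemma flat_surj: "length xs = 2 * n \<Longrightarrow> \<exists>ps. flat ps = xs"
proof (induction n arbitrary: xs)
  case (Suc n)
  then obtain b a ys where xs: "xs = b # a # ys" by (cases xs rule: remdups_adj.cases) auto
  with Suc obtain ps where "flat ps = ys" by auto
  then have "flat ((a, b) # ps) = xs" by (simp add: xs)
  then show ?case by blast
qed (auto intro: exI[of _ "[]"])

lemma flat_map_upt:
  "flat (map (\<lambda>k. (f (2 * k - 1), f (2 * k))) (rev [1..<Suc n])) = rev (map f [1..<Suc (2 * n)])"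
  by (induction n) auto

definition pfaff_pairs :: "('n::{finite,linorder} \<times> 'n) list set" where
  "pfaff_pairs = {ps. (\<forall>(a, b)\<in>set ps. a < b) \<and> flat ps \<in> permutations_of_set UNIV}"

text \<open>Flattening the pairs of \<open>\<sigma>\<close> gives the reversed list of its values,
  for which \<open>dyn_S_tilde\<close> is a product over ascents.\<close>

lemma dyn_Pf_eq:
  fixes x :: "'n::{finite,linorder} \<Rightarrow> 'n \<Rightarrow> 'a::ring_1"
  assumes N: "CARD('n) = 2 * n"
  shows "dyn_Pf l \<iota> x = (\<Sum>ps\<in>pfaff_pairs.
    \<iota> (pairprod (wt (<) (hm l)) (flat ps)) * prod_list (map (\<lambda>(a, b). x b a) ps))"
proof -
  define pairs where "pairs = (\<lambda>\<sigma>. map (\<lambda>k. (nth_el (UNIV :: 'n set) (\<sigma> (2 * k - 1)),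
      nth_el (UNIV :: 'n set) (\<sigma> (2 * k)))) (rev [1..<Suc n]))"
  let ?C = "{\<sigma>. \<sigma> permutes {1..CARD('n)} \<and> (\<forall>k\<in>{1..CARD('n) div 2}. \<sigma> (2 * k - 1) < \<sigma> (2 * k))}"
  have flat_pairs: "flat (pairs \<sigma>) = rev (perm_list UNIV \<sigma>)" for \<sigma>
    unfolding pairs_def perm_list_def N
    by (rule flat_map_upt[of "\<lambda>k. nth_el UNIV (\<sigma> k)"])
  have inc: "(\<forall>(a, b)\<in>set (pairs \<sigma>). a < b) \<longleftrightarrow>
      (\<forall>k\<in>{1..CARD('n) div 2}. \<sigma> (2 * k - 1) < \<sigma> (2 * k))" if s: "\<sigma> permutes {1..CARD('n)}" for \<sigma>
  proof -
    have "nth_el (UNIV :: 'n set) (\<sigma> (2 * k - 1)) < nth_el UNIV (\<sigma> (2 * k)) \<longleftrightarrow> \<sigma> (2 * k - 1) < \<sigma> (2 * k)"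
      if "k \<in> {1..n}" for k
    proof (rule nth_el_less_iff)
      have "2 * k - 1 \<in> {1..CARD('n)}" "2 * k \<in> {1..CARD('n)}" using that N by auto
      then show "\<sigma> (2 * k - 1) \<in> {1..CARD('n)}" "\<sigma> (2 * k) \<in> {1..CARD('n)}"
        by (simp_all only: permutes_in_image[OF s])
    qed
    then show ?thesis
      by (auto simp: pairs_def N atLeastLessThanSuc_atLeastAtMost simp del: upt_Suc)
  qed
  note bij = bij_betw_perm_list[of "UNIV :: 'n set"]
  have "bij_betw pairs ?C pfaff_pairs"
  proof (rule bij_betwI')
    fix \<sigma> \<tau> assume "\<sigma> \<in> ?C" "\<tau> \<in> ?C"
    then show "pairs \<sigma> = pairs \<tau> \<longleftrightarrow> \<sigma> = \<tau>"
      using bij_betw_imp_inj_on[OF bij] flat_pairs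
      by (metis (no_types, lifting) inj_onD mem_Collect_eq rev_is_rev_conv)
  next
    fix \<sigma> assume s: "\<sigma> \<in> ?C"
    then have "perm_list UNIV \<sigma> \<in> permutations_of_set (UNIV :: 'n set)"
      using bij_betwE[OF bij] by blast
    then have "flat (pairs \<sigma>) \<in> permutations_of_set UNIV"
      unfolding flat_pairs by (auto simp: permutations_of_set_def)
    then show "pairs \<sigma> \<in> pfaff_pairs" using s inc by (simp add: pfaff_pairs_def)
  next
    fix ps :: "('n \<times> 'n) list" assume ps: "ps \<in> pfaff_pairs"
    then have "rev (flat ps) \<in> permutations_of_set UNIV"
      by (auto simp: permutations_of_set_def pfaff_pairs_def)
    then obtain \<sigma> where s: "\<sigma> permutes {1..CARD('n)}" "rev (flat ps) = perm_list UNIV \<sigma>"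
      using bij unfolding bij_betw_def by auto
    then have "flat ps = rev (perm_list UNIV \<sigma>)" by (metis rev_rev_ident)
    then have "ps = pairs \<sigma>" using flat_pairs flat_inject by metis
    moreover have "\<sigma> \<in> ?C" using ps s(1) inc \<open>ps = pairs \<sigma>\<close> by (simp add: pfaff_pairs_def)
    ultimately show "\<exists>\<sigma>\<in>?C. ps = pairs \<sigma>" by blast
  qed
  from sum.reindex_bij_betw[OF this, symmetric]
  have "(\<Sum>ps\<in>pfaff_pairs. \<iota> (pairprod (wt (<) (hm l)) (flat ps)) * prod_list (map (\<lambda>(a, b). x b a) ps)) =
      (\<Sum>\<sigma>\<in>?C. \<iota> (pairprod (wt (<) (hm l)) (flat (pairs \<sigma>))) *
        prod_list (map (\<lambda>(a, b). x b a) (pairs \<sigma>)))" .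
  also have "\<dots> = dyn_Pf l \<iota> x"
    unfolding dyn_Pf_def
  proof (rule sum.cong[OF refl])
    fix \<sigma> assume "\<sigma> \<in> ?C"
    then have "dyn_S_tilde l \<sigma> (UNIV :: 'n set) = pairprod (wt (<) (hm l)) (flat (pairs \<sigma>))"
      unfolding flat_pairs by (intro dyn_S_tilde_eq) auto
    moreover have "map (\<lambda>(a, b). x b a) (pairs \<sigma>) =
        map (\<lambda>k. x (nth_el UNIV (\<sigma> (2 * k))) (nth_el UNIV (\<sigma> (2 * k - 1)))) (rev [1..<Suc (CARD('n) div 2)])"
      by (simp add: pairs_def N del: upt_Suc)
    ultimately show "\<iota> (pairprod (wt (<) (hm l)) (flat (pairs \<sigma>))) *
          prod_list (map (\<lambda>(a, b). x b a) (pairs \<sigma>)) =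
        \<iota> (dyn_S_tilde l \<sigma> UNIV) * prod_list (map (\<lambda>k. x (nth_el UNIV (\<sigma> (2 * k)))
          (nth_el UNIV (\<sigma> (2 * k - 1)))) (rev [1..<Suc (CARD('n) div 2)]))" by simp
  qed
  finally show ?thesis by simp
qed

section \<open>Orientations of the pairs\<close>

definition ordered :: "'b::linorder \<times> 'b \<Rightarrow> 'b \<times> 'b" where
  "ordered p = (min (fst p) (snd p), max (fst p) (snd p))"

lemma map_ordered_Cons:
  assumes "a < b"
  shows "{qs. map ordered qs = (a, b) # ps} =
    (#) (a, b) ` {qs. map ordered qs = ps} \<union> (#) (b, a) ` {qs. map ordered qs = ps}"
proof -
  have "ordered p = (a, b) \<longleftrightarrow> p = (a, b) \<or> p = (b, a)" for p
    using assms by (cases p) (auto simp: ordered_def min_def max_def)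
  then show ?thesis by (auto simp: map_eq_Cons_conv)
qed

lemma finite_map_ordered: "\<forall>(a, b)\<in>set ps. a < b \<Longrightarrow> finite {qs. map ordered qs = ps}"
  by (induction ps) (auto simp: map_ordered_Cons)

lemma sum_map_ordered_Cons:
  assumes "a < b" "\<forall>(a, b)\<in>set ps. a < b"
  shows "(\<Sum>qs | map ordered qs = (a, b) # ps. f qs) =
    (\<Sum>qs | map ordered qs = ps. f ((a, b) # qs) + f ((b, a) # qs))"
  unfolding map_ordered_Cons[OF assms(1)] using assms finite_map_ordered[OF assms(2)]
  by (subst sum.union_disjoint) (auto simp: sum.reindex sum.distrib)

lemma mset_flat_map_ordered: "mset (flat (map ordered qs)) = mset (flat qs)"
  by (induction qs rule: flat.induct) (auto simp: ordered_def min_def max_def)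

text \<open>The part of the sign of \<open>flat qs\<close> that comes from inversions inside the
  pairs.\<close>

definition swap_wt :: "('b \<Rightarrow> 'b \<Rightarrow> bool) \<Rightarrow> ('b \<Rightarrow> 'b \<Rightarrow> 'f::comm_ring_1) \<Rightarrow> ('b \<times> 'b) list \<Rightarrow> 'f" where
  "swap_wt P h qs = prod_list (map (\<lambda>(a, b). wt P h b a) qs)"

text \<open>Reorienting a pair leaves the weights between different pairs unchanged as a whole, and
  an increasing pair has inner weight 1.\<close>

lemma pairprod_map_ordered:
  "distinct (flat qs) \<Longrightarrow>
   pairprod (wt (<) h) (flat qs) = pairprod (wt (<) h) (flat (map ordered qs)) * swap_wt (<) h qs"
proof (induction qs rule: flat.induct)
  case (2 a b qs)
  let ?p = "\<lambda>x. prod_list (map (wt (<) h x) (flat qs))"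
  have p: "prod_list (map (wt (<) h x) (flat (map ordered qs))) = ?p x" for x
    by (metis mset_flat_map_ordered mset_map prod_mset_prod_list)
  have IH: "pairprod (wt (<) h) (flat qs) =
      pairprod (wt (<) h) (flat (map ordered qs)) * swap_wt (<) h qs"
    using 2 by simp
  have sw: "swap_wt (<) h ((a, b) # qs) = wt (<) h b a * swap_wt (<) h qs"
    by (simp add: swap_wt_def)
  have "a \<noteq> b" using 2 by auto
  then consider "a < b" | "b < a" by fastforce
  then show ?case
  proof cases
    case 1
    then have "ordered (a, b) = (a, b)" "wt (<) h b a = 1" by (auto simp: ordered_def wt_def)
    then show ?thesis by (simp add: p sw IH mult_ac)
  next
    case 2
    then have "ordered (a, b) = (b, a)" "wt (<) h a b = 1" by (auto simp: ordered_def wt_def)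
    then show ?thesis by (simp add: p sw IH mult_ac)
  qed
qed (simp add: swap_wt_def)


section \<open>Transformation of the Pfaffian\<close>

lemma prod_list_sum:
  fixes F :: "'r \<Rightarrow> 'p \<Rightarrow> 'a::ring_1"
  assumes "finite A"
  shows "prod_list (map (\<lambda>p. \<Sum>r\<in>A. F r p) ps) =
    (\<Sum>rs | set rs \<subseteq> A \<and> length rs = length ps. prod_list (map2 F rs ps))"
proof (induction ps)
  case (Cons p ps)
  let ?L = "{rs. set rs \<subseteq> A \<and> length rs = length ps}"
  have eq: "{rs. set rs \<subseteq> A \<and> length rs = length (p # ps)} = (\<lambda>(r, rs). r # rs) ` (A \<times> ?L)"
    by (auto simp: length_Suc_conv)
  have "(\<Sum>rs | set rs \<subseteq> A \<and> length rs = length (p # ps). prod_list (map2 F rs (p # ps))) =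
      (\<Sum>(r, rs)\<in>A \<times> ?L. F r p * prod_list (map2 F rs ps))"
    unfolding eq by (subst sum.reindex) (auto simp: inj_on_def intro!: sum.cong)
  also have "\<dots> = (\<Sum>r\<in>A. F r p) * (\<Sum>rs\<in>?L. prod_list (map2 F rs ps))"
    by (simp add: sum_product sum.cartesian_product)
  finally show ?case by (simp add: Cons)
next
  case Nil
  have "{rs. set rs \<subseteq> A \<and> length rs = length []} = {[]}" by auto
  then show ?case by simp
qed

lemma mero_shift_mult: "mero_shift i (f * g) = mero_shift i f * mero_shift i g"
  by transfer (auto intro!: merom_mult merom_shift)

lemma mero_shift_1: "mero_shift i 1 = 1"
  by transfer simp

context generic_q
begin

lemma mero_shift_swap_wt:
  "i \<notin> set (flat qs) \<Longrightarrow> mero_shift i (swap_wt (<) (hm l) qs) = swap_wt (<) (hm l) qs"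
  by (induction qs rule: flat.induct)
    (auto simp: swap_wt_def mero_shift_1 mero_shift_mult wt_def mero_shift_hm rows.mero_shift_uminus)

text \<open>Each minor is a sum of two terms, one for each order of its columns; \<open>qs\<close>
  records the choices. The weights are collected on the left, which is possible because different
  minors use disjoint columns.\<close>

lemma prod_minors:
  fixes rs ps :: "('n \<times> 'n) list"
  assumes "length rs = length ps" "\<forall>(k, m)\<in>set rs. k < m" "\<forall>(a, b)\<in>set ps. a < b"
    and "distinct (flat ps)"
  shows "prod_list (map2 (\<lambda>(k, m) (a, b). minor l {k, m} {a, b}) rs ps) \<doteq>
    (\<Sum>qs | map ordered qs = ps.
       mu_r (swap_wt (<) (hm l) qs) * mon (\<lambda>x y. t_el y x) (flat qs) (flat rs))"
  using assms
proof (induction rs ps rule: list_induct2)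
  case Nil
  show ?case using cong_sym[OF mur.hom_one] by (simp add: swap_wt_def)
next
  case (Cons r rs p ps)
  obtain k m a b where rp: "r = (k, m)" "p = (a, b)" "k < m" "a < b"
    using Cons.prems by (cases r, cases p) auto
  let ?T = "\<lambda>x y. t_el y x :: 'n fr_gen free_alg"
  let ?w = "swap_wt (<) (hm l)"
  let ?Q = "quad mu_r (hm l) ?T b a m k"
  have pos: "\<forall>(a, b)\<in>set ps. a < b" using Cons.prems by simp
  have IH: "prod_list (map2 (\<lambda>(k, m) (a, b). minor l {k, m} {a, b}) rs ps) \<doteq>
      (\<Sum>qs | map ordered qs = ps. mu_r (?w qs) * mon ?T (flat qs) (flat rs))"
    by (rule Cons.IH) (use Cons.prems rp in auto)
  have "prod_list (map2 (\<lambda>(k, m) (a, b). minor l {k, m} {a, b}) (r # rs) (p # ps)) =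
      minor l {k, m} {a, b} * prod_list (map2 (\<lambda>(k, m) (a, b). minor l {k, m} {a, b}) rs ps)"
    by (simp add: rp)
  also have "\<dots> \<doteq> ?Q * (\<Sum>qs | map ordered qs = ps. mu_r (?w qs) * mon ?T (flat qs) (flat rs))"
    by (intro cong_mult IH minor_column_expansion rp)
  also have "\<dots> = (\<Sum>qs | map ordered qs = ps. ?Q * (mu_r (?w qs) * mon ?T (flat qs) (flat rs)))"
    by (rule sum_distrib_left)
  also have "\<dots> \<doteq> (\<Sum>qs | map ordered qs = ps.
      mu_r (?w ((a, b) # qs)) * mon ?T (flat ((a, b) # qs)) (flat (r # rs)) +
      mu_r (?w ((b, a) # qs)) * mon ?T (flat ((b, a) # qs)) (flat (r # rs)))"
  proof (rule cong_sum)
    fix qs assume "qs \<in> {qs. map ordered qs = ps}"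
    then have "mset (flat qs) = mset (flat ps)" using mset_flat_map_ordered[of qs] by simp
    then have "set (flat qs) = set (flat ps)" by (rule mset_eq_setD)
    then have ab: "a \<notin> set (flat qs)" "b \<notin> set (flat qs)" using Cons.prems rp by auto
    let ?M = "mon ?T (flat qs) (flat rs)"
    \<comment> \<open>The columns \<open>a, b\<close> do not occur in \<open>qs\<close>, so their
      shifts fix the weight of \<open>qs\<close>.\<close>
    have comm: "?T x m * ?T y k * mu_r (?w qs) \<doteq> mu_r (?w qs) * (?T x m * ?T y k)"
      if "x \<in> {a, b}" "y \<in> {a, b}" for x y
    proof -
      have "mu_r (?w qs) * mon ?T [x, y] [m, k] \<doteq> mon ?T [x, y] [m, k] * mu_r (?w qs)"
        by (rule cols.left_mon) (use ab that in \<open>auto simp: mero_shift_swap_wt\<close>)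
      from cong_sym[OF this] show ?thesis by simp
    qed
    have w: "?w ((a, b) # qs) = ?w qs" "?w ((b, a) # qs) = ?w qs * (- hm l a b)"
      using rp by (auto simp: swap_wt_def wt_def mult.commute)
    have "?Q * (mu_r (?w qs) * ?M) = ?T b m * ?T a k * mu_r (?w qs) * ?M +
        mu_r (- hm l a b) * (?T a m * ?T b k * mu_r (?w qs)) * ?M"
      by (simp add: quad_def algebra_simps)
    also have "\<dots> \<doteq> mu_r (?w qs) * (?T b m * ?T a k) * ?M +
        mu_r (- hm l a b) * (mu_r (?w qs) * (?T a m * ?T b k)) * ?M"
      by (intro cong_add cong_mult_right cong_mult_left comm) auto
    also have "\<dots> = mu_r (?w qs) * (?T b m * ?T a k * ?M) +
        mu_r (- hm l a b) * mu_r (?w qs) * (?T a m * ?T b k * ?M)"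
      by (simp add: mult.assoc)
    also have "\<dots> \<doteq> mu_r (?w qs) * (?T b m * ?T a k * ?M) +
        mu_r (- hm l a b * ?w qs) * (?T a m * ?T b k * ?M)"
      by (intro cong_add cong_mult_right cong_refl cong_sym[OF mur.hom_mult])
    finally show "?Q * (mu_r (?w qs) * ?M) \<doteq>
        mu_r (?w ((a, b) # qs)) * mon ?T (flat ((a, b) # qs)) (flat (r # rs)) +
        mu_r (?w ((b, a) # qs)) * mon ?T (flat ((b, a) # qs)) (flat (r # rs))"
      unfolding w by (simp add: rp mult.assoc mult.commute[of "hm l a b"])
  qed
  also have "\<dots> = (\<Sum>qs | map ordered qs = p # ps. mu_r (?w qs) * mon ?T (flat qs) (flat (r # rs)))"
    unfolding rp(2) by (rule sum_map_ordered_Cons[OF rp(4) pos, symmetric])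
  finally show ?case .
qed

text \<open>A partition of the columns into increasing pairs together with an orientation of each
  pair is an arbitrary arrangement of the columns, and the two signs multiply to the sign of that
  arrangement.\<close>

lemma sum_prod_minors:
  fixes rs :: "('n \<times> 'n) list"
  assumes N: "CARD('n) = 2 * n" and rs: "length rs = n" "\<forall>(k, m)\<in>set rs. k < m"
  shows "(\<Sum>ps\<in>pfaff_pairs. mu_r (pairprod (wt (<) (hm l)) (flat ps)) *
      prod_list (map2 (\<lambda>(k, m) (a, b). minor l {k, m} {a, b}) rs ps)) \<doteq> cols.Phi (flat rs)"
proof -
  let ?W = "pairprod (wt (<) (hm l))" and ?w = "swap_wt (<) (hm l)"
  let ?M = "\<lambda>xs. mon (\<lambda>x y. t_el y x :: 'n fr_gen free_alg) xs (flat rs)"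
  let ?Q = "{qs. flat qs \<in> permutations_of_set (UNIV :: 'n set)}"
  have fib: "{qs. map ordered qs = ps} = {qs. qs \<in> ?Q \<and> map ordered qs = ps}"
    if "ps \<in> pfaff_pairs" for ps :: "('n \<times> 'n) list"
  proof -
    have "flat qs \<in> permutations_of_set UNIV" if "map ordered qs = ps" for qs
    proof -
      have m: "mset (flat qs) = mset (flat ps)" using mset_flat_map_ordered[of qs] that by simp
      show ?thesis
        using \<open>ps \<in> pfaff_pairs\<close> mset_eq_setD[OF m] mset_eq_imp_distinct_iff[OF m]
        by (simp add: pfaff_pairs_def permutations_of_set_def)
    qed
    then show ?thesis by blast
  qed
  have bij: "bij_betw flat ?Q (permutations_of_set (UNIV :: 'n set))"
    unfolding bij_betw_def
  proof
    show "inj_on flat ?Q" using flat_inject by (auto intro: inj_onI)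
    show "flat ` ?Q = permutations_of_set (UNIV :: 'n set)"
    proof
      show "permutations_of_set UNIV \<subseteq> flat ` ?Q"
      proof
        fix xs :: "'n list" assume xs: "xs \<in> permutations_of_set UNIV"
        then obtain qs where "flat qs = xs"
          using flat_surj[of xs n] N length_finite_permutations_of_set by metis
        then show "xs \<in> flat ` ?Q" using xs by blast
      qed
    qed auto
  qed
  then have finQ: "finite ?Q" by (simp add: bij_betw_finite)
  have into: "map ordered ` ?Q \<subseteq> pfaff_pairs"
  proof
    fix ps assume "ps \<in> map ordered ` ?Q"
    then obtain qs where qs: "ps = map ordered qs" "distinct (flat qs)" "set (flat qs) = UNIV"
      by (auto simp: permutations_of_set_def)
    have "distinct (flat qs) \<Longrightarrow> \<forall>(a, b)\<in>set (map ordered qs). a < b"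
      by (induction qs rule: flat.induct) (auto simp: ordered_def min_def max_def)
    moreover have "distinct (flat ps)" "set (flat ps) = UNIV"
      using qs mset_eq_imp_distinct_iff[OF mset_flat_map_ordered[of qs]]
        mset_eq_setD[OF mset_flat_map_ordered[of qs]] by simp_all
    ultimately show "ps \<in> pfaff_pairs" using qs by (auto simp: pfaff_pairs_def)
  qed
  have "finite (pfaff_pairs :: ('n \<times> 'n) list set)"
    by (rule finite_subset[OF _ finQ]) (auto simp: pfaff_pairs_def)
  \<comment> \<open>All arrangements are grouped by their lists of increasing pairs.\<close>
  note group = sum.group[OF finQ this into]
  have "(\<Sum>ps\<in>pfaff_pairs. mu_r (?W (flat ps)) *
        prod_list (map2 (\<lambda>(k, m) (a, b). minor l {k, m} {a, b}) rs ps)) \<doteq>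
      (\<Sum>ps\<in>pfaff_pairs. mu_r (?W (flat ps)) *
        (\<Sum>qs | map ordered qs = ps. mu_r (?w qs) * ?M (flat qs)))"
  proof (intro cong_sum cong_mult_left)
    fix ps :: "('n \<times> 'n) list" assume ps: "ps \<in> pfaff_pairs"
    then have "length (flat ps) = CARD('n)"
      unfolding pfaff_pairs_def using length_finite_permutations_of_set by blast
    then have "length rs = length ps" using N rs by simp
    then show "prod_list (map2 (\<lambda>(k, m) (a, b). minor l {k, m} {a, b}) rs ps) \<doteq>
        (\<Sum>qs | map ordered qs = ps. mu_r (?w qs) * ?M (flat qs))"
      using ps rs by (intro prod_minors) (auto simp: pfaff_pairs_def permutations_of_set_def)
  qed
  also have "\<dots> = (\<Sum>ps\<in>pfaff_pairs. \<Sum>qs | qs \<in> ?Q \<and> map ordered qs = ps.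
      mu_r (?W (flat (map ordered qs))) * mu_r (?w qs) * ?M (flat qs))"
  proof (rule sum.cong[OF refl])
    fix ps :: "('n \<times> 'n) list" assume "ps \<in> pfaff_pairs"
    note fib = fib[OF this]
    show "mu_r (?W (flat ps)) * (\<Sum>qs | map ordered qs = ps. mu_r (?w qs) * ?M (flat qs)) =
        (\<Sum>qs | qs \<in> ?Q \<and> map ordered qs = ps.
          mu_r (?W (flat (map ordered qs))) * mu_r (?w qs) * ?M (flat qs))"
      unfolding fib[symmetric] sum_distrib_left by (rule sum.cong) (auto simp: mult.assoc)
  qed
  also have "\<dots> = (\<Sum>qs\<in>?Q. mu_r (?W (flat (map ordered qs))) * mu_r (?w qs) * ?M (flat qs))"
    by (rule group)
  also have "\<dots> \<doteq> (\<Sum>qs\<in>?Q. mu_r (?W (flat qs)) * ?M (flat qs))"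
  proof (intro cong_sum cong_mult_right)
    fix qs assume "qs \<in> ?Q"
    then have "?W (flat qs) = ?W (flat (map ordered qs)) * ?w qs"
      by (intro pairprod_map_ordered) (auto simp: permutations_of_set_def)
    then show "mu_r (?W (flat (map ordered qs))) * mu_r (?w qs) \<doteq> mu_r (?W (flat qs))"
      using cong_sym[OF mur.hom_mult] by simp
  qed
  also have "\<dots> = cols.Phi (flat rs)"
    unfolding cols.Phi_def by (rule sum.reindex_bij_betw[OF bij])
  finally show ?thesis .
qed

text \<open>Since \<open>bt_null\<close> is only a linear subspace, these congruences are added but
  never multiplied.\<close>

definition bt_cong :: "'n tens_alg \<Rightarrow> 'n tens_alg \<Rightarrow> bool" (infix \<open>\<sim>\<^sub>t\<close> 50) where
  "x \<sim>\<^sub>t y \<longleftrightarrow> x - y \<in> bt_null l"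

lemma bt_cong_refl [simp]: "x \<sim>\<^sub>t x"
  by (simp add: bt_cong_def bt_null_def cs.span_zero)

lemma bt_cong_sym: "x \<sim>\<^sub>t y \<Longrightarrow> y \<sim>\<^sub>t x"
  unfolding bt_cong_def bt_null_def using cs.span_neg[of "x - y"] by simp

lemma bt_cong_trans [trans]: "x \<sim>\<^sub>t y \<Longrightarrow> y \<sim>\<^sub>t z \<Longrightarrow> x \<sim>\<^sub>t z"
  unfolding bt_cong_def bt_null_def using cs.span_add[of "x - y" _ "y - z"] by simp

lemma bt_cong_add: "x \<sim>\<^sub>t x' \<Longrightarrow> y \<sim>\<^sub>t y' \<Longrightarrow> x + y \<sim>\<^sub>t x' + y'"
  unfolding bt_cong_def bt_null_def using cs.span_add[of "x - x'" _ "y - y'"]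
  by (simp add: algebra_simps)

lemma bt_cong_sum: "(\<And>x. x \<in> A \<Longrightarrow> f x \<sim>\<^sub>t g x) \<Longrightarrow> sum f A \<sim>\<^sub>t sum g A"
  by (induction A rule: infinite_finite_induct) (auto intro: bt_cong_add)

lemma bt_cong_rel: "x - y \<in> tensor_rels l \<union> balance_rels \<Longrightarrow> x \<sim>\<^sub>t y"
  unfolding bt_cong_def bt_null_def by (rule cs.span_base)

lemma tens_add_left: "(x + x') \<otimes>\<^sub>t y \<sim>\<^sub>t x \<otimes>\<^sub>t y + x' \<otimes>\<^sub>t y"
  by (rule bt_cong_rel, unfold tensor_rels_def, (rule UnI1)+, blast)

lemma tens_add_right: "x \<otimes>\<^sub>t (y + y') \<sim>\<^sub>t x \<otimes>\<^sub>t y + x \<otimes>\<^sub>t y'"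
  by (rule bt_cong_rel, unfold tensor_rels_def, ((rule UnI2, blast) | rule UnI1)+)

lemma tens_balance: "x \<otimes>\<^sub>t (mu_l f * y) \<sim>\<^sub>t (mu_b f * x) \<otimes>\<^sub>t y"
  by (rule bt_cong_rel, rule UnI2, unfold balance_rels_def) blast

lemma tens_null_left: "x \<in> B_ideal \<Longrightarrow> x \<otimes>\<^sub>t y \<sim>\<^sub>t 0"
  by (rule bt_cong_rel, rule UnI1, unfold tensor_rels_def diff_zero) blast

lemma tens_null_right: "y \<in> FR \<Longrightarrow> x \<otimes>\<^sub>t y \<sim>\<^sub>t 0"
  by (rule bt_cong_rel, rule UnI1, unfold tensor_rels_def diff_zero) blast

lemma tens_cong_right:
  assumes "y \<doteq> y'"
  shows "x \<otimes>\<^sub>t y \<sim>\<^sub>t x \<otimes>\<^sub>t y'"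
proof -
  have "x \<otimes>\<^sub>t y = x \<otimes>\<^sub>t (y' + (y - y'))" by simp
  also have "\<dots> \<sim>\<^sub>t x \<otimes>\<^sub>t y' + x \<otimes>\<^sub>t (y - y')" by (rule tens_add_right)
  also have "\<dots> \<sim>\<^sub>t x \<otimes>\<^sub>t y' + 0"
    using assms by (intro bt_cong_add tens_null_right) (auto simp: cong_def)
  finally show ?thesis by simp
qed

lemma tens_sum_right: "x \<otimes>\<^sub>t (\<Sum>i\<in>A. f i) \<sim>\<^sub>t (\<Sum>i\<in>A. x \<otimes>\<^sub>t f i)"
proof (induction A rule: infinite_finite_induct)
  case (insert i A)
  have "x \<otimes>\<^sub>t (f i + sum f A) \<sim>\<^sub>t x \<otimes>\<^sub>t f i + x \<otimes>\<^sub>t sum f A" by (rule tens_add_right)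
  also have "\<dots> \<sim>\<^sub>t x \<otimes>\<^sub>t f i + (\<Sum>i\<in>A. x \<otimes>\<^sub>t f i)" by (intro bt_cong_add insert) simp
  finally show ?case using insert by simp
qed (auto intro: tens_null_right simp: zero_in)

lemma tens_sum_left: "(\<Sum>i\<in>A. f i) \<otimes>\<^sub>t y \<sim>\<^sub>t (\<Sum>i\<in>A. f i \<otimes>\<^sub>t y)"
proof (induction A rule: infinite_finite_induct)
  case (insert i A)
  have "(f i + sum f A) \<otimes>\<^sub>t y \<sim>\<^sub>t f i \<otimes>\<^sub>t y + sum f A \<otimes>\<^sub>t y" by (rule tens_add_left)
  also have "\<dots> \<sim>\<^sub>t f i \<otimes>\<^sub>t y + (\<Sum>i\<in>A. f i \<otimes>\<^sub>t y)" by (intro bt_cong_add insert) simp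
  finally show ?case using insert by simp
qed (auto intro!: tens_null_left simp: B_ideal_def ideal_gen_def cs.span_zero)

text \<open>An equality rather than a congruence: products are evaluated on the symbols before any
  relation is imposed.\<close>

lemma prod_list_tens:
  "length rs = length ps \<Longrightarrow> prod_list (map2 (\<lambda>r p. f r \<otimes>\<^sub>t g r p) rs ps) =
     prod_list (map f rs) \<otimes>\<^sub>t prod_list (map2 g rs ps)"
proof (induction rs ps rule: list_induct2)
  case Nil
  show ?case by (simp add: tens_def zero_tsym_def[symmetric])
qed (simp add: tens_mult)

text \<open>Expanding all entries gives a sum over arbitrary lists \<open>rs\<close> of row pairs.
  Those with a repeated row contribute 0, and the others are exactly the index set of the Pfaffian
  on the right.\<close>

lemma pfaffian_transformation:
  assumes N: "CARD('n) = 2 * n"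
  shows "dyn_Pf l bt_act (c_el l :: 'n \<Rightarrow> 'n \<Rightarrow> 'n tens_alg) \<sim>\<^sub>t dyn_Pf l mu_b b_el \<otimes>\<^sub>t det_T l"
proof -
  let ?W = "pairprod (wt (<) (hm l :: 'n \<Rightarrow> _))"
  let ?A = "{(k, m). k < (m :: 'n)}"
  let ?R = "{rs. set rs \<subseteq> ?A \<and> length rs = n}"
  let ?B = "\<lambda>rs. prod_list (map (\<lambda>(k, m). b_el m k :: 'n b_gen free_alg) rs)"
  let ?M = "\<lambda>rs ps. prod_list (map2 (\<lambda>(k, m) (a, b). minor l {k, m} {a, b :: 'n}) rs ps)"
  have len: "length ps = n" if "ps \<in> pfaff_pairs" for ps :: "('n \<times> 'n) list"
  proof -
    have "length (flat ps) = CARD('n)"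
      using that unfolding pfaff_pairs_def using length_finite_permutations_of_set by blast
    then show ?thesis using N by simp
  qed
  have finR: "finite ?R" by (rule finite_lists_length_eq) simp
  have c: "c_el l b a = (\<Sum>r\<in>?A. (\<lambda>(k, m). b_el m k) r \<otimes>\<^sub>t (\<lambda>(k, m) (a, b). minor l {k, m} {a, b}) r (a, b))"
    for a b :: 'n
    unfolding c_el_def by (intro sum.cong) auto
  have "prod_list (map (\<lambda>(a, b). c_el l b a) ps) = (\<Sum>rs\<in>?R. ?B rs \<otimes>\<^sub>t ?M rs ps)"
    if "ps \<in> pfaff_pairs" for ps :: "('n \<times> 'n) list"
  proof -
    have "prod_list (map (\<lambda>(a, b). c_el l b a) ps) = prod_list (map (\<lambda>p. \<Sum>r\<in>?A.
        (\<lambda>(k, m). b_el m k) r \<otimes>\<^sub>t (\<lambda>(k, m) (a, b). minor l {k, m} {a, b}) r p) ps)"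
      by (intro arg_cong[of _ _ prod_list] map_cong refl) (auto simp: c split: prod.splits)
    also have "\<dots> = (\<Sum>rs | set rs \<subseteq> ?A \<and> length rs = length ps. prod_list (map2 (\<lambda>r p.
        (\<lambda>(k, m). b_el m k) r \<otimes>\<^sub>t (\<lambda>(k, m) (a, b). minor l {k, m} {a, b}) r p) rs ps))"
      by (rule prod_list_sum) simp
    also have "\<dots> = (\<Sum>rs\<in>?R. ?B rs \<otimes>\<^sub>t ?M rs ps)"
      unfolding len[OF that] by (intro sum.cong refl prod_list_tens) (simp add: len[OF that])
    finally show ?thesis .
  qed
  then have "dyn_Pf l bt_act (c_el l) =
      (\<Sum>ps\<in>pfaff_pairs. \<Sum>rs\<in>?R. ?B rs \<otimes>\<^sub>t (mu_r (?W (flat ps)) * ?M rs ps))"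
    unfolding dyn_Pf_eq[OF N] by (intro sum.cong refl) (simp add: sum_distrib_left bt_act_tens)
  also have "\<dots> = (\<Sum>rs\<in>?R. \<Sum>ps\<in>pfaff_pairs. ?B rs \<otimes>\<^sub>t (mu_r (?W (flat ps)) * ?M rs ps))"
    by (rule sum.swap)
  also have "\<dots> \<sim>\<^sub>t (\<Sum>rs\<in>?R. ?B rs \<otimes>\<^sub>t (\<Sum>ps\<in>pfaff_pairs. mu_r (?W (flat ps)) * ?M rs ps))"
    by (intro bt_cong_sum bt_cong_sym[OF tens_sum_right])
  also have "\<dots> \<sim>\<^sub>t (\<Sum>rs\<in>?R. if rs \<in> pfaff_pairs then (mu_b (?W (flat rs)) * ?B rs) \<otimes>\<^sub>t det_T l else 0)"
  proof (rule bt_cong_sum)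
    fix rs :: "('n \<times> 'n) list" assume rs: "rs \<in> ?R"
    then have "length (flat rs) = CARD('n)" using N by simp
    \<comment> \<open>A list of \<open>2n\<close> indices is an arrangement of all of them once it
      has no repetition.\<close>
    then have iff: "rs \<in> pfaff_pairs \<longleftrightarrow> distinct (flat rs)"
      using rs by (auto simp: pfaff_pairs_def permutations_of_set_def
          intro!: card_eq_UNIV_imp_eq_UNIV simp: distinct_card)
    have "(\<Sum>ps\<in>pfaff_pairs. mu_r (?W (flat ps)) * ?M rs ps) \<doteq> cols.Phi (flat rs)"
      using rs by (intro sum_prod_minors[OF N]) auto
    also have "\<dots> \<doteq> (if distinct (flat rs) then mu_l (?W (flat rs)) * det_T l else 0)"
      by (rule cols_Phi) fact
    finally have "?B rs \<otimes>\<^sub>t (\<Sum>ps\<in>pfaff_pairs. mu_r (?W (flat ps)) * ?M rs ps) \<sim>\<^sub>t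
        ?B rs \<otimes>\<^sub>t (if distinct (flat rs) then mu_l (?W (flat rs)) * det_T l else 0)"
      by (rule tens_cong_right)
    \<comment> \<open>The balancing relation carries the sign of the rows from \<open>mu_l\<close>
      to \<open>mu_b\<close>.\<close>
    also have "\<dots> \<sim>\<^sub>t (if rs \<in> pfaff_pairs then (mu_b (?W (flat rs)) * ?B rs) \<otimes>\<^sub>t det_T l else 0)"
      unfolding iff by (auto intro: tens_balance tens_null_right simp: zero_in)
    finally show "?B rs \<otimes>\<^sub>t (\<Sum>ps\<in>pfaff_pairs. mu_r (?W (flat ps)) * ?M rs ps) \<sim>\<^sub>t
        (if rs \<in> pfaff_pairs then (mu_b (?W (flat rs)) * ?B rs) \<otimes>\<^sub>t det_T l else 0)" .
  qed
  also have "(\<Sum>rs\<in>?R. if rs \<in> pfaff_pairs then (mu_b (?W (flat rs)) * ?B rs) \<otimes>\<^sub>t det_T l else 0) =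
      (\<Sum>rs\<in>pfaff_pairs. (mu_b (?W (flat rs)) * ?B rs) \<otimes>\<^sub>t det_T l)"
  proof -
    have "?R \<inter> pfaff_pairs = pfaff_pairs" using len by (auto simp: pfaff_pairs_def)
    then show ?thesis by (simp add: sum.inter_restrict[OF finR, symmetric])
  qed
  also have "\<dots> \<sim>\<^sub>t (\<Sum>rs\<in>pfaff_pairs. mu_b (?W (flat rs)) * ?B rs) \<otimes>\<^sub>t det_T l"
    by (rule bt_cong_sym[OF tens_sum_left])
  also have "(\<Sum>rs\<in>pfaff_pairs. mu_b (?W (flat rs)) * ?B rs) = dyn_Pf l mu_b b_el"
    by (rule dyn_Pf_eq[OF N, symmetric])
  finally show ?thesis .
qed

end

theorem theorem4p4:
  fixes q l :: complex and n :: nat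
  assumes "exp l = q"
    and "\<And>k::nat. k > 0 \<Longrightarrow> q ^ k \<noteq> 1"
    and "CARD('n::{finite,linorder}) = 2 * n"
  shows "bt_class l (dyn_Pf l bt_act (c_el l :: 'n \<Rightarrow> 'n \<Rightarrow> 'n tens_alg)) =
         bt_class l (dyn_Pf l mu_b b_el \<otimes>\<^sub>t det_T l)"
proof -
  interpret generic_q q l "TYPE('n)" by standard (use assms in auto)
  have "dyn_Pf l bt_act (c_el l :: 'n \<Rightarrow> 'n \<Rightarrow> 'n tens_alg) \<sim>\<^sub>t dyn_Pf l mu_b b_el \<otimes>\<^sub>t det_T l"
    by (rule pfaffian_transformation[OF assms(3)])
  then show ?thesis
    unfolding bt_class_def bt_cong_def[symmetric]
    by (blast intro: bt_cong_trans bt_cong_sym)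
qed

end
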